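(* Consider the direct equivalence problem for fourth order differential operators $\mathcal D=\sum_{i=0}^4 f_i(x)D^i$, with the initial coframe $\omega^1,\dots,\omega^6$ described in the context. The final structure equations, i.e. those of the final invariant coframe $\theta^1,\dots,\theta^6$, are $$d\theta^1=\tfrac14\,\theta^1\wedge\theta^2,$$ $$d\theta^2=\theta^1\wedge\theta^3,$$ $$d\theta^3=\theta^1\wedge\theta^4+\tfrac14\,\theta^2\wedge\theta^3,$$ $$d\theta^4=I_1\,\theta^1\wedge\theta^3+\theta^1\wedge\theta^5+\tfrac12\,\theta^2\wedge\theta^4,$$ $$d\theta^5=I\,\theta^1\wedge\theta^2+I_2\,\theta^1\wedge\theta^3+I_3\,\theta^1\wedge\theta^4+\theta^1\wedge\theta^6+\tfrac34\,\theta^2\wedge\theta^5+3\,\theta^3\wedge\theta^4,$$ $$d\theta^6=0,$$ where the coefficients $I_1,I_2,I_3$ and $I$ are $$I_1=-\frac{\sqrt[4]{f_4u}}{2f_4u}\big[5f_4p-3\dot f_4u+2f_3u\big],$$ $$\begin{aligned}I_2=\frac{1}{64f_4^2u^2\sqrt[4]{f_4u}}\Big[&\big(20f_3\dot f_4^2-16f_3f_4\ddot f_4-45\dot f_4^3-16f_4^2\dddot f_4+64f_1f_4^2-16f_2f_4\dot f_4+60f_4\dot f_4\ddot f_4\big)u^3\\&+35f_4^3p^3+240f_4u^2r+\big(65f_4\dot f_4^2-52f_4^2\ddot f_4+112f_2f_4^2-40f_3f_4\dot f_4\big)u^2p\\&-100f_4^3upq+(17\dot f_4-28f_3)f_4^2up^2+\big(176f_3\dot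 f_4^2-84f_4^2\dot f_4\big)u^2q\Big],\end{aligned}$$ $$I_3=-\frac{1}{16f_4\sqrt{f_4uu}}\Big[\big(16f_2f_4+5\dot f_4^2-16f_4\dot f_3+8f_4\ddot f_4\big)u^2+5f_4p^2+40f_4^2uq+(32f_3-38\dot f_4)f_4up\Big],$$ $$I=-(f_4s+f_3r+f_2q+f_1p+f_0u).$$
   Context: The coefficients $f_0,\dots,f_4$ are analytic functions of the real variable $x$, $D=d/dx$, and dots denote derivatives with respect to $x$. The fourth jet space $\mathrm J^4$ of scalar functions $u(x)$ has coordinates $(x,u,p,q,r,s)$ with $p=u_x$, $q=u_{xx}$, $r=u_{xxx}$, $s=u_{xxxx}$; one works on a connected component $\Gamma$ of the subset of $\mathrm J^4$ where $u\neq0$ and $f_4(x)\neq0$. The direct equivalence problem asks when two fourth order operators $\mathcal D=\sum_{i=0}^4 f_i(x)D^i$ and $\bar{\mathcal D}=\sum_{i=0}^4\bar f_i(\bar x)\bar D^i$ (with $\bar D=d/d\bar x$) satisfy $\mathcal D[u]=\bar{\mathcal D}[\bar u]$, equivalently $\bar{\mathcal D}=\mathcal D\cdot\frac1{\varphi(x)}$, under a fiber-preserving transformation $\bar x=\xi(x)$, $\bar u=\varphi(x)u$ with $\varphi\neq0$. The initial coframe on $\Gamma$ is $$\omega^1=dx,\quad \omega^2=\frac{du-p\,dx}{u},\quad \omega^3=dp-q\,dx,\quad \omega^4=dq-r\,dx,\quad \omega^5=dr-s\,dx,$$ $$\omega^6=d\big(\mathcal D[u]\big)=f_4\,ds+f_3\,dr+f_2\,dq+f_1\,dp+f_0\,du+(\dot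 f_4s+\dot f_3r+\dot f_2q+\dot f_1p+\dot f_0u)\,dx.$$ The structure group of the problem gives the lifted coframe $$\theta^1=a_1\omega^1,\ \ \theta^2=\omega^2,\ \ \theta^3=a_2\omega^2+a_3\omega^3,\ \ \theta^4=a_4\omega^2+a_5\omega^3+a_6\omega^4,\ \ \theta^5=a_7\omega^2+a_8\omega^3+a_9\omega^4+a_{10}\omega^5,\ \ \theta^6=\omega^6,$$ with $a_1a_3a_6a_{10}\neq0$. The final invariant coframe is the one obtained from this lifted coframe by Cartan's equivalence method, i.e. after all group parameters $a_1,\dots,a_{10}$ have been successively normalized to functions on the jet space by setting essential torsion coefficients equal to constants. The final structure equations express the $d\theta^i$ of this coframe in terms of the $\theta^j\wedge\theta^k$.
   Formalization: Corrected: the I₁ term of dθ⁴ is I₁θ¹∧θ⁴; I₂ has an overall minus sign, 240f₄³u²r and 176f₃f₄²; I₃ has 5f₄²p² and denominator 16f₄√(f₄u)·u. Taken with a₁>0; the coframe exists where f₄u>0 (otherwise the fourth root is not real). *)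

theory Defs
  imports "HOL-Analysis.Analysis"
begin

definition real_analytic_on :: "(real \<Rightarrow> real) \<Rightarrow> real set \<Rightarrow> bool" where
  "real_analytic_on h U \<longleftrightarrow>
    (\<forall>x\<in>U. \<exists>c. \<exists>e>0. \<forall>y. \<bar>y - x\<bar> < e \<longrightarrow> (\<lambda>n. c n * (y - x) ^ n) sums h y)"

text \<open>A point of the fourth jet space is a vector \<open>z :: real^6\<close> with coordinates
  \<open>(x, u, p, q, r, s) = (z $ 1, z $ 2, z $ 3, z $ 4, z $ 5, z $ 6)\<close>.
  An operator is given by its coefficients: \<open>f i\<close> multiplies the \<open>i\<close>-th derivative.\<close>

definition jet_operator :: "(nat \<Rightarrow> real \<Rightarrow> real) \<Rightarrow> real^6 \<Rightarrow> real" where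
  "jet_operator f z =
     f 4 (z $ 1) * z $ 6 + f 3 (z $ 1) * z $ 5 + f 2 (z $ 1) * z $ 4
     + f 1 (z $ 1) * z $ 3 + f 0 (z $ 1) * z $ 2"

definition jet_domain :: "(nat \<Rightarrow> real \<Rightarrow> real) \<Rightarrow> real set \<Rightarrow> (real^6) set" where
  "jet_domain f U = {z. z $ 1 \<in> U \<and> z $ 2 \<noteq> 0 \<and> f 4 (z $ 1) \<noteq> 0}"

text \<open>A one-form takes a point and a tangent vector, a two-form a point and two tangent
  vectors. The formula for \<open>ext_d\<close> is the invariant formula for the exterior derivative,
  evaluated on constant vector fields.\<close>

type_synonym 'm form1 = "'m \<Rightarrow> 'm \<Rightarrow> real"
type_synonym 'm form2 = "'m \<Rightarrow> 'm \<Rightarrow> 'm \<Rightarrow> real"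

definition d_fun :: "('m::real_normed_vector \<Rightarrow> real) \<Rightarrow> 'm form1" where
  "d_fun h = (\<lambda>z v. frechet_derivative h (at z) v)"

definition ext_d :: "'m::real_normed_vector form1 \<Rightarrow> 'm form2" where
  "ext_d \<alpha> = (\<lambda>z v w. frechet_derivative (\<lambda>y. \<alpha> y w) (at z) v
                    - frechet_derivative (\<lambda>y. \<alpha> y v) (at z) w)"

definition wedge :: "('m \<Rightarrow> real) \<Rightarrow> ('m \<Rightarrow> real) \<Rightarrow> 'm \<Rightarrow> 'm \<Rightarrow> real" where
  "wedge \<alpha> \<beta> = (\<lambda>v w. \<alpha> v * \<beta> w - \<alpha> w * \<beta> v)"

text \<open>Coframes are indexed by \<open>1, \<dots>, 6\<close>; the last clause of each case distinction is the
  case of index \<open>6\<close>.\<close>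

definition omega :: "(nat \<Rightarrow> real \<Rightarrow> real) \<Rightarrow> nat \<Rightarrow> (real^6) form1" where
  "omega f i = (\<lambda>z v.
     if i = 1 then v $ 1
     else if i = 2 then (v $ 2 - z $ 3 * v $ 1) / z $ 2
     else if i = 3 then v $ 3 - z $ 4 * v $ 1
     else if i = 4 then v $ 4 - z $ 5 * v $ 1
     else if i = 5 then v $ 5 - z $ 6 * v $ 1
     else d_fun (jet_operator f) z v)"

definition structure_group :: "(real^10) set" where
  "structure_group = {a. a $ 1 * a $ 3 * a $ 6 * a $ 10 \<noteq> 0}"

definition group_act :: "real^10 \<Rightarrow> (nat \<Rightarrow> real) \<Rightarrow> nat \<Rightarrow> real" where
  "group_act a w i =
    (if i = 1 then a $ 1 * w 1
     else if i = 2 then w 2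
     else if i = 3 then a $ 2 * w 2 + a $ 3 * w 3
     else if i = 4 then a $ 4 * w 2 + a $ 5 * w 3 + a $ 6 * w 4
     else if i = 5 then a $ 7 * w 2 + a $ 8 * w 3 + a $ 9 * w 4 + a $ 10 * w 5
     else w 6)"

text \<open>During the reduction, \<open>K\<close> is the set of group parameters that are still free; the other
  ones have been replaced by the components of \<open>\<sigma>\<close>, functions on the jet space. The partially
  reduced lifted coframe consists of one-forms on \<open>jet space \<times> group\<close>. For \<open>K = UNIV\<close> it is the
  lifted coframe itself.\<close>

definition params :: "10 set \<Rightarrow> (real^6 \<Rightarrow> real^10) \<Rightarrow> real^6 \<Rightarrow> real^10 \<Rightarrow> real^10" where
  "params K \<sigma> z a = (\<chi> \<kappa>. if \<kappa> \<in> K then a $ \<kappa> else \<sigma> z $ \<kappa>)"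

definition lifted :: "(nat \<Rightarrow> real \<Rightarrow> real) \<Rightarrow> 10 set \<Rightarrow> (real^6 \<Rightarrow> real^10)
    \<Rightarrow> nat \<Rightarrow> ((real^6) \<times> (real^10)) form1" where
  "lifted f K \<sigma> i = (\<lambda>P X. group_act (params K \<sigma> (fst P) (snd P))
                              (\<lambda>j. omega f j (fst P) (fst X)) i)"

definition lifted_param_deriv :: "(nat \<Rightarrow> real \<Rightarrow> real) \<Rightarrow> 10 set \<Rightarrow> (real^6 \<Rightarrow> real^10)
    \<Rightarrow> 10 \<Rightarrow> nat \<Rightarrow> ((real^6) \<times> (real^10)) form1" where
  "lifted_param_deriv f K \<sigma> \<kappa> i = (\<lambda>P X.
     frechet_derivative (\<lambda>a. lifted f K \<sigma> i (fst P, a) X) (at (snd P)) (axis \<kappa> 1))"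

text \<open>The numbers \<open>T i j k\<close> (\<open>j < k\<close>) are torsion coefficients at \<open>P\<close> if
  \<open>d\<theta>\<^sup>i = (\<Sum>\<kappa>\<in>K. \<pi>\<^sup>\<kappa> \<and> \<partial>\<theta>\<^sup>i/\<partial>a\<^sub>\<kappa>) + (\<Sum>j<k. T i j k \<theta>\<^sup>j \<and> \<theta>\<^sup>k)\<close> holds there for some one-forms
  \<open>\<pi>\<^sup>\<kappa>\<close> congruent to \<open>da\<^sub>\<kappa>\<close> modulo the coframe. The Maurer-Cartan forms of the group are
  a change of basis of the \<open>da\<^sub>\<kappa>\<close>, and \<open>\<partial>\<theta>\<^sup>i/\<partial>a\<^sub>\<kappa>\<close> is a combination of the \<open>\<theta>\<^sup>j\<close>, so these are
  the structure equations after an arbitrary modification of the Maurer-Cartan forms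
  (absorption of torsion). A coefficient is essential if it is the same for all such
  modifications.\<close>

definition is_torsion :: "(nat \<Rightarrow> real \<Rightarrow> real) \<Rightarrow> 10 set \<Rightarrow> (real^6 \<Rightarrow> real^10)
    \<Rightarrow> (real^6) \<times> (real^10) \<Rightarrow> (nat \<Rightarrow> nat \<Rightarrow> nat \<Rightarrow> real) \<Rightarrow> bool" where
  "is_torsion f K \<sigma> P T \<longleftrightarrow>
    (\<exists>\<pi>. (\<forall>\<kappa>\<in>K. \<exists>\<zeta>. \<forall>X. \<pi> \<kappa> X = snd X $ \<kappa> + (\<Sum>j = 1..6. \<zeta> j * lifted f K \<sigma> j P X)) \<and>
      (\<forall>i\<in>{1..6}. \<forall>X Y. ext_d (lifted f K \<sigma> i) P X Y =
         (\<Sum>\<kappa>\<in>K. wedge (\<pi> \<kappa>) (lifted_param_deriv f K \<sigma> \<kappa> i P) X Y)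
         + (\<Sum>j = 1..6. \<Sum>k = j+1..6.
              T i j k * wedge (lifted f K \<sigma> j P) (lifted f K \<sigma> k P) X Y)))"

definition essential_torsion :: "(nat \<Rightarrow> real \<Rightarrow> real) \<Rightarrow> 10 set \<Rightarrow> (real^6 \<Rightarrow> real^10)
    \<Rightarrow> (real^6) \<times> (real^10) \<Rightarrow> nat \<Rightarrow> nat \<Rightarrow> nat \<Rightarrow> real \<Rightarrow> bool" where
  "essential_torsion f K \<sigma> P i j k c \<longleftrightarrow>
    (\<exists>T. is_torsion f K \<sigma> P T) \<and> (\<forall>T. is_torsion f K \<sigma> P T \<longrightarrow> T i j k = c)"

text \<open>One loop of the method: at the stage with free parameters \<open>K\<close>, the essential torsion
  coefficients listed in \<open>N\<close> are made equal to the prescribed constants by setting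
  \<open>a\<^sub>\<kappa> = \<sigma>\<^sub>\<kappa>(z)\<close> for \<open>\<kappa> \<in> K - K'\<close>, whatever the values of the parameters in \<open>K'\<close>, which
  remain free.\<close>

definition normalization_step :: "(nat \<Rightarrow> real \<Rightarrow> real) \<Rightarrow> (real^6) set \<Rightarrow> (real^6 \<Rightarrow> real^10)
    \<Rightarrow> 10 set \<Rightarrow> 10 set \<Rightarrow> (nat \<times> nat \<times> nat \<times> real) set \<Rightarrow> bool" where
  "normalization_step f \<Gamma> \<sigma> K K' N \<longleftrightarrow>
    (\<forall>z\<in>\<Gamma>. \<forall>a\<in>structure_group. (\<forall>\<kappa>\<in>K - K'. a $ \<kappa> = \<sigma> z $ \<kappa>) \<longrightarrow>
       (\<forall>(i, j, k, c)\<in>N. essential_torsion f K \<sigma> (z, a) i j k c))"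

text \<open>The reduction takes three loops, which normalize first \<open>a\<^sub>1, a\<^sub>2, a\<^sub>3, a\<^sub>6, a\<^sub>1\<^sub>0\<close>, then
  \<open>a\<^sub>4, a\<^sub>5, a\<^sub>9\<close>, then \<open>a\<^sub>7, a\<^sub>8\<close>. In the second loop both \<open>T\<^sup>4\<^sub>1\<^sub>4\<close> and \<open>T\<^sup>5\<^sub>1\<^sub>5\<close> are essential and
  depend on \<open>a\<^sub>9\<close>; the latter is the one that is normalized. The first loop forces
  \<open>a\<^sub>1\<^sup>4 f\<^sub>4 u = 1\<close> and leaves the sign of \<open>a\<^sub>1\<close> open; the invariants below, written with the
  principal fourth root, belong to \<open>a\<^sub>1 > 0\<close>.\<close>

definition cartan_normalization :: "(nat \<Rightarrow> real \<Rightarrow> real) \<Rightarrow> (real^6) set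
    \<Rightarrow> (real^6 \<Rightarrow> real^10) \<Rightarrow> bool" where
  "cartan_normalization f \<Gamma> \<sigma> \<longleftrightarrow>
    (\<forall>z\<in>\<Gamma>. \<sigma> z \<in> structure_group \<and> \<sigma> differentiable (at z)) \<and>
    normalization_step f \<Gamma> \<sigma> UNIV {4, 5, 7, 8, 9}
      {(2, 1, 2, 0), (2, 1, 3, 1), (3, 1, 4, 1), (4, 1, 5, 1), (5, 1, 6, 1)} \<and>
    normalization_step f \<Gamma> \<sigma> {4, 5, 7, 8, 9} {7, 8}
      {(3, 1, 2, 0), (3, 1, 3, 0), (5, 1, 5, 0)} \<and>
    normalization_step f \<Gamma> \<sigma> {7, 8} {}
      {(4, 1, 2, 0), (4, 1, 3, 0)}"

definition reduced_coframe :: "(nat \<Rightarrow> real \<Rightarrow> real) \<Rightarrow> (real^6 \<Rightarrow> real^10)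
    \<Rightarrow> nat \<Rightarrow> (real^6) form1" where
  "reduced_coframe f \<sigma> i = (\<lambda>z v. group_act (\<sigma> z) (\<lambda>j. omega f j z v) i)"

text \<open>Misprints in the published formulas have been corrected: in \<open>inv2\<close> the overall sign, the
  factor \<open>f4^3\<close> of \<open>u^2 * r\<close> and the factor \<open>f4^2\<close> in \<open>176 * f3 * f4^2\<close>; in \<open>inv3\<close> the factor
  \<open>f4^2\<close> of \<open>p^2\<close>. In the structure equation of \<open>d\<theta>\<^sup>4\<close>, \<open>inv1\<close> is the coefficient of
  \<open>\<theta>\<^sup>1 \<and> \<theta>\<^sup>4\<close>, where \<open>\<theta>\<^sup>1 \<and> \<theta>\<^sup>3\<close> is printed.\<close>

definition inv1 :: "(nat \<Rightarrow> real \<Rightarrow> real) \<Rightarrow> real^6 \<Rightarrow> real" where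
  "inv1 f z = (let x = z $ 1; u = z $ 2; p = z $ 3;
     f3 = f 3 x; f4 = f 4 x; df4 = deriv (f 4) x in
     - (root 4 (f4 * u) / (2 * f4 * u)) * (5 * f4 * p - 3 * df4 * u + 2 * f3 * u))"

definition inv2 :: "(nat \<Rightarrow> real \<Rightarrow> real) \<Rightarrow> real^6 \<Rightarrow> real" where
  "inv2 f z = (let x = z $ 1; u = z $ 2; p = z $ 3; q = z $ 4; r = z $ 5;
     f1 = f 1 x; f2 = f 2 x; f3 = f 3 x; f4 = f 4 x;
     df4 = deriv (f 4) x; ddf4 = (deriv ^^ 2) (f 4) x; dddf4 = (deriv ^^ 3) (f 4) x in
     - (1 / (64 * f4^2 * u^2 * root 4 (f4 * u))) *
     ((20 * f3 * df4^2 - 16 * f3 * f4 * ddf4 - 45 * df4^3 - 16 * f4^2 * dddf4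
         + 64 * f1 * f4^2 - 16 * f2 * f4 * df4 + 60 * f4 * df4 * ddf4) * u^3
      + 35 * f4^3 * p^3 + 240 * f4^3 * u^2 * r
      + (65 * f4 * df4^2 - 52 * f4^2 * ddf4 + 112 * f2 * f4^2 - 40 * f3 * f4 * df4) * u^2 * p
      - 100 * f4^3 * u * p * q + (17 * df4 - 28 * f3) * f4^2 * u * p^2
      + (176 * f3 * f4^2 - 84 * f4^2 * df4) * u^2 * q))"

definition inv3 :: "(nat \<Rightarrow> real \<Rightarrow> real) \<Rightarrow> real^6 \<Rightarrow> real" where
  "inv3 f z = (let x = z $ 1; u = z $ 2; p = z $ 3; q = z $ 4;
     f2 = f 2 x; f3 = f 3 x; f4 = f 4 x;
     df3 = deriv (f 3) x; df4 = deriv (f 4) x; ddf4 = (deriv ^^ 2) (f 4) x in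
     - (1 / (16 * f4 * sqrt (f4 * u) * u)) *
     ((16 * f2 * f4 + 5 * df4^2 - 16 * f4 * df3 + 8 * f4 * ddf4) * u^2
      + 5 * f4^2 * p^2 + 40 * f4^2 * u * q + (32 * f3 - 38 * df4) * f4 * u * p))"

definition inv0 :: "(nat \<Rightarrow> real \<Rightarrow> real) \<Rightarrow> real^6 \<Rightarrow> real" where
  "inv0 f z = (let x = z $ 1; u = z $ 2; p = z $ 3; q = z $ 4; r = z $ 5; s = z $ 6 in
     - (f 4 x * s + f 3 x * r + f 2 x * q + f 1 x * p + f 0 x * u))"

end

theory Submission
  imports Defs
begin

text \<open>
  The reduction has exactly one solution with \<open>a\<^sub>1 > 0\<close>, which requires \<open>f\<^sub>4 u > 0\<close>, and it becomes
  simple in quantities that are adapted to the scaling of \<open>u\<close>. Put \<open>P = p/u\<close>, \<open>Q = q/u\<close>, \<open>R = r/u\<close>, \<open>S = s/u\<close>, divide the coefficients of the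
  operator by \<open>f\<^sub>4\<close> (in particular \<open>h = f\<^sub>4'/f\<^sub>4\<close> and \<open>k = f\<^sub>3/f\<^sub>4\<close>), and let \<open>b\<close> be the fourth root of
  \<open>f\<^sub>4 u\<close>. The ratios have the contact forms \<open>\<zeta>\<^sup>3 = dP - (Q - P\<^sup>2) dx\<close>, \<open>\<zeta>\<^sup>4 = dQ - (R - P Q) dx\<close>,
  \<open>\<zeta>\<^sup>5 = dR - (S - P R) dx\<close> (\<open>ratio_form\<close>), and \<open>d\<omega>\<^sup>2 = dx \<and> \<zeta>\<^sup>3\<close>. Each \<open>d\<zeta>\<^sup>i\<close> is \<open>dx\<close> wedge a
  combination of \<open>\<omega>\<^sup>2, \<zeta>\<^sup>3, \<zeta>\<^sup>4, \<zeta>\<^sup>5, \<omega>\<^sup>6\<close> whose coefficients are polynomials in the ratios and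
  \<open>1/b\<close> (\<open>ext_d_ratio_form\<close>).

  The invariant coframe is \<open>\<theta>\<^sup>1 = dx/b\<close>, \<open>\<theta>\<^sup>2 = \<omega>\<^sup>2\<close>, \<open>\<theta>\<^sup>3 = b \<zeta>\<^sup>3\<close>, \<open>\<theta>\<^sup>4 = b\<^sup>2(\<zeta>\<^sup>4 + \<mu>\<^sub>4\<^sub>3 \<zeta>\<^sup>3)\<close>,
  \<open>\<theta>\<^sup>5 = b\<^sup>3(\<zeta>\<^sup>5 + \<mu>\<^sub>5\<^sub>4 \<zeta>\<^sup>4 + \<mu>\<^sub>5\<^sub>3 \<zeta>\<^sup>3)\<close>, \<open>\<theta>\<^sup>6 = \<omega>\<^sup>6\<close> (\<open>normal_coframe\<close>). Since
  \<open>db = b/4 ((h + P) dx + \<omega>\<^sup>2)\<close>, the factors \<open>1/b, b, b\<^sup>2, b\<^sup>3\<close> produce the terms with \<open>\<theta>\<^sup>2\<close> and the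
  numbers \<open>1/4, 1/2, 3/4\<close>, while \<open>d\<mu>\<^sub>5\<^sub>4\<close> and \<open>d\<mu>\<^sub>5\<^sub>3\<close> produce \<open>3 \<theta>\<^sup>3 \<and> \<theta>\<^sup>4\<close>; all remaining terms
  are multiples of \<open>\<theta>\<^sup>1\<close>. The three functions \<open>\<mu>\<close> are the values that remove
  \<open>\<theta>\<^sup>1 \<and> \<theta>\<^sup>3\<close> from \<open>d\<theta>\<^sup>3\<close>, \<open>\<theta>\<^sup>1 \<and> \<theta>\<^sup>5\<close> from \<open>d\<theta>\<^sup>5\<close> and \<open>\<theta>\<^sup>1 \<and> \<theta>\<^sup>3\<close> from \<open>d\<theta>\<^sup>4\<close>. In these
  terms the structure equations are identities of polynomials (\<open>structure_equations_123\<close>,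
  \<open>structure_equation_4\<close>, \<open>structure_equation_5\<close>).

  It remains to see that the method leads to this coframe and to no other
  (\<open>cartan_normalization_iff\<close>). Absorption changes the structure equation of \<open>\<theta>\<^sup>i\<close> only by wedge
  products with the forms \<open>\<partial>\<theta>\<^sup>i/\<partial>a\<^sub>\<kappa>\<close>. Where these vanish on two vectors \<open>E\<^sub>j, E\<^sub>k\<close> of the dual frame,
  the torsion coefficient \<open>T\<^sup>i\<^sub>j\<^sub>k\<close> is therefore essential, with the value \<open>d\<theta>\<^sup>i(E\<^sub>j, E\<^sub>k)\<close> computed with
  the free parameters held constant (\<open>essential_torsion_iff\<close>). This covers every coefficient that
  is normalized, so each loop is a system of equations for group parameters. The first is
  solved directly and yields \<open>a\<^sub>1\<^sup>4 f\<^sub>4 u = 1\<close>. For the others the structure equations themselves do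
  most of the work: writing \<open>\<vartheta>\<close> for the coframe above, one knows
  \<open>d\<theta>\<^sup>3 = \<theta>\<^sup>1 \<and> \<vartheta>\<^sup>4 + 1/4 \<theta>\<^sup>2 \<and> \<theta>\<^sup>3\<close> as soon as the first loop is done, hence \<open>T\<^sup>3\<^sub>1\<^sub>k = \<vartheta>\<^sup>4(E\<^sub>k)\<close>, and
  this vanishes for \<open>k = 2, 3\<close> exactly if the parameters of \<open>\<theta>\<^sup>4\<close> are those of \<open>\<vartheta>\<^sup>4\<close>. The same
  argument with \<open>d\<theta>\<^sup>4\<close> and \<open>\<vartheta>\<^sup>5\<close> settles the third loop.
\<close>

section \<open>Analytic functions and their derivatives\<close>

lemma power_series_has_derivative:
  fixes c :: "nat \<Rightarrow> real"
  assumes sums: "\<And>y. \<bar>y - x\<bar> < e \<Longrightarrow> (\<lambda>n. c n * (y - x) ^ n) sums h y" and y: "\<bar>y - x\<bar> < e"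
  shows "\<exists>d. (\<lambda>n. diffs c n * (y - x) ^ n) sums d \<and> (h has_real_derivative d) (at y)"
proof -
  \<comment> \<open>a radius of convergence strictly beyond \<open>y\<close>, as termwise differentiation requires\<close>
  define K where "K = (\<bar>y - x\<bar> + e) / 2"
  have K: "\<bar>y - x\<bar> < K" "K < e" using y by (auto simp: K_def)
  have sK: "summable (\<lambda>n. c n * K ^ n)"
    using sums[of "x + K"] K by (auto simp: sums_iff)
  have sd: "summable (\<lambda>n. diffs c n * (y - x) ^ n)"
    by (rule termdiff_converges[where K = e])
      (use y sums[of "x + _"] in \<open>auto simp: sums_iff\<close>)
  have "((\<lambda>t. \<Sum>n. c n * t ^ n) has_real_derivative (\<Sum>n. diffs c n * (y - x) ^ n)) (at (y - x))"
    by (rule termdiffs_strong[OF sK]) (use K in auto)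
  then have 1: "((\<lambda>t. \<Sum>n. c n * (t - x) ^ n) has_real_derivative (\<Sum>n. diffs c n * (y - x) ^ n)) (at y)"
    using DERIV_shift[of "\<lambda>t. \<Sum>n. c n * t ^ n" _ y "- x"] by simp
  have 2: "\<forall>\<^sub>F t in nhds y. (\<Sum>n. c n * (t - x) ^ n) = h t"
  proof (rule eventually_nhds_in_open[THEN eventually_mono])
    show "open (ball x e)" "y \<in> ball x e" using y by (auto simp: dist_real_def)
  next
    fix t assume "t \<in> ball x e"
    then show "(\<Sum>n. c n * (t - x) ^ n) = h t"
      using sums[of t] by (auto simp: dist_real_def sums_iff abs_minus_commute)
  qed
  have "(h has_real_derivative (\<Sum>n. diffs c n * (y - x) ^ n)) (at y)"
    using 1 DERIV_cong_ev[OF refl 2 refl] by simp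
  then show ?thesis using sd by (auto simp: sums_iff)
qed

lemma real_analytic_on_differentiable:
  assumes "real_analytic_on h U" "x \<in> U"
  shows "h differentiable at x"
proof -
  obtain c e where "e > 0" "\<And>y. \<bar>y - x\<bar> < e \<Longrightarrow> (\<lambda>n. c n * (y - x) ^ n) sums h y"
    using assms unfolding real_analytic_on_def by metis
  then obtain d where "(h has_real_derivative d) (at x)"
    using power_series_has_derivative[of x e c h x] by auto
  then show ?thesis using real_differentiable_def by blast
qed

lemma real_analytic_on_deriv:
  assumes "real_analytic_on h U"
  shows "real_analytic_on (deriv h) U"
  unfolding real_analytic_on_def
proof
  fix x assume "x \<in> U"
  then obtain c e where e: "e > 0" and s: "\<And>y. \<bar>y - x\<bar> < e \<Longrightarrow> (\<lambda>n. c n * (y - x) ^ n) sums h y"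
    using assms unfolding real_analytic_on_def by metis
  have "(\<lambda>n. diffs c n * (y - x) ^ n) sums deriv h y" if "\<bar>y - x\<bar> < e" for y
    using power_series_has_derivative[of x e c h y] s that DERIV_imp_deriv by blast
  with e show "\<exists>c. \<exists>e>0. \<forall>y. \<bar>y - x\<bar> < e \<longrightarrow> (\<lambda>n. c n * (y - x) ^ n) sums deriv h y"
    by blast
qed

lemma real_analytic_on_higher_deriv:
  "real_analytic_on h U \<Longrightarrow> real_analytic_on ((deriv ^^ n) h) U"
  by (induction n) (auto intro: real_analytic_on_deriv)

section \<open>The exterior derivative\<close>

lemma ext_d_eqI:
  assumes "\<And>w. ((\<lambda>y. \<alpha> y w) has_derivative D w) (at z)"
  shows "ext_d \<alpha> z v w = D w v - D v w"
  unfolding ext_d_def by (simp only: frechet_derivative_at[OF assms, symmetric])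

lemma d_fun_eqI: "(h has_derivative D) (at z) \<Longrightarrow> d_fun h z v = D v"
  unfolding d_fun_def by (drule frechet_derivative_at) simp

lemma ext_d_cong:
  assumes "open S" "z \<in> S" "\<And>y v. y \<in> S \<Longrightarrow> \<alpha> y v = \<beta> y v"
  shows "ext_d \<alpha> z v w = ext_d \<beta> z v w"
proof -
  have "frechet_derivative (\<lambda>y. \<alpha> y v) (at z) = frechet_derivative (\<lambda>y. \<beta> y v) (at z)" for v
  proof -
    have "((\<lambda>y. \<alpha> y v) has_derivative D) (at z) = ((\<lambda>y. \<beta> y v) has_derivative D) (at z)" for D
      using has_derivative_transform_within_open[OF _ assms(1,2)] assms(3) by (smt (verit))
    then show ?thesis unfolding frechet_derivative_def by simp
  qed
  then show ?thesis by (simp add: ext_d_def)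
qed

lemma ext_d_add:
  assumes "\<And>v. (\<lambda>y. \<alpha> y v) differentiable at z" "\<And>v. (\<lambda>y. \<beta> y v) differentiable at z"
  shows "ext_d (\<lambda>y v. \<alpha> y v + \<beta> y v) z v w = ext_d \<alpha> z v w + ext_d \<beta> z v w"
proof -
  have "((\<lambda>y. \<alpha> y w + \<beta> y w) has_derivative
    (\<lambda>v. frechet_derivative (\<lambda>y. \<alpha> y w) (at z) v + frechet_derivative (\<lambda>y. \<beta> y w) (at z) v)) (at z)" for w
    using assms by (intro has_derivative_add) (simp_all add: frechet_derivative_works[symmetric])
  from ext_d_eqI[where \<alpha> = "\<lambda>y v. \<alpha> y v + \<beta> y v", OF this] show ?thesis
    by (simp add: ext_d_def[of \<alpha>] ext_d_def[of \<beta>])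
qed

lemma ext_d_mult:
  assumes "g differentiable at z" "\<And>v. (\<lambda>y. \<alpha> y v) differentiable at z"
  shows "ext_d (\<lambda>y v. g y * \<alpha> y v) z v w = wedge (d_fun g z) (\<alpha> z) v w + g z * ext_d \<alpha> z v w"
proof -
  have "((\<lambda>y. g y * \<alpha> y w) has_derivative
    (\<lambda>v. g z * frechet_derivative (\<lambda>y. \<alpha> y w) (at z) v + d_fun g z v * \<alpha> z w)) (at z)" for w
    unfolding d_fun_def
    using assms by (intro has_derivative_mult) (simp_all add: frechet_derivative_works[symmetric])
  from ext_d_eqI[where \<alpha> = "\<lambda>y v. g y * \<alpha> y v", OF this] show ?thesis
    by (simp add: ext_d_def[of \<alpha>] wedge_def algebra_simps)
qed

lemma d_fun_cong:
  assumes "open S" "z \<in> S" "\<And>y. y \<in> S \<Longrightarrow> g y = h y"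
  shows "d_fun g z v = d_fun h z v"
proof -
  have "(g has_derivative D) (at z) = (h has_derivative D) (at z)" for D
    using has_derivative_transform_within_open[OF _ assms(1,2)] assms(3) by (smt (verit))
  then show ?thesis unfolding d_fun_def frechet_derivative_def by simp
qed

text \<open>Linearity in each slot concerns both a directional derivative, which is linear in the direction,
  and the evaluation of \<open>\<alpha>\<close> at a fixed vector, which has to be linear at all points near \<open>z\<close>
  because it is differentiated.\<close>
lemma linear_ext_d:
  assumes "open S" "z \<in> S" "\<And>y. y \<in> S \<Longrightarrow> linear (\<alpha> y)" "\<And>v. (\<lambda>y. \<alpha> y v) differentiable at z"
  shows "linear (\<lambda>v. ext_d \<alpha> z v w)" "linear (\<lambda>w. ext_d \<alpha> z v w)"
proof -
  have "frechet_derivative (\<lambda>y. \<alpha> y (a + b)) (at z) w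
    = frechet_derivative (\<lambda>y. \<alpha> y a) (at z) w + frechet_derivative (\<lambda>y. \<alpha> y b) (at z) w" for a b w
  proof -
    have "((\<lambda>y. \<alpha> y a + \<alpha> y b) has_derivative (\<lambda>w. frechet_derivative (\<lambda>y. \<alpha> y a) (at z) w
      + frechet_derivative (\<lambda>y. \<alpha> y b) (at z) w)) (at z)"
      using assms(4) by (intro has_derivative_add) (simp_all flip: frechet_derivative_works)
    then have "((\<lambda>y. \<alpha> y (a + b)) has_derivative (\<lambda>w. frechet_derivative (\<lambda>y. \<alpha> y a) (at z) w
      + frechet_derivative (\<lambda>y. \<alpha> y b) (at z) w)) (at z)"
      by (rule has_derivative_transform_within_open[OF _ assms(1,2)]) (simp add: assms(3) linear_add)
    then show ?thesis by (drule_tac frechet_derivative_at) (simp add: fun_eq_iff)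
  qed
  moreover have "frechet_derivative (\<lambda>y. \<alpha> y (r *\<^sub>R a)) (at z) w
    = r * frechet_derivative (\<lambda>y. \<alpha> y a) (at z) w" for r a w
  proof -
    have "((\<lambda>y. r * \<alpha> y a) has_derivative (\<lambda>w. r * frechet_derivative (\<lambda>y. \<alpha> y a) (at z) w)) (at z)"
      using assms(4) by (intro has_derivative_mult_right) (simp flip: frechet_derivative_works)
    then have "((\<lambda>y. \<alpha> y (r *\<^sub>R a)) has_derivative
        (\<lambda>w. r * frechet_derivative (\<lambda>y. \<alpha> y a) (at z) w)) (at z)"
      by (rule has_derivative_transform_within_open[OF _ assms(1,2)]) (simp add: assms(3) linear_scale)
    then show ?thesis by (drule_tac frechet_derivative_at) (simp add: fun_eq_iff)
  qed
  ultimately show "linear (\<lambda>v. ext_d \<alpha> z v w)" "linear (\<lambda>w. ext_d \<alpha> z v w)"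
    using linear_frechet_derivative[OF assms(4)]
    by (auto intro!: linearI simp: ext_d_def linear_add linear_scale algebra_simps)
qed

lemma two_form_expansion:
  fixes B :: "'m::real_vector \<Rightarrow> 'm \<Rightarrow> real"
  assumes lin: "\<And>w. linear (\<lambda>v. B v w)" "\<And>v. linear (B v)" and alt: "\<And>v w. B v w = - B w v"
    and E: "\<And>v. v = (\<Sum>j = 1..6. \<theta> j v *\<^sub>R E j)"
  shows "B v w = (\<Sum>j = 1..6. \<Sum>k = j+1..6::nat. B (E j) (E k) * wedge (\<theta> j) (\<theta> k) v w)"
proof -
  have I: "{1..6::nat} = {1,2,3,4,5,6}" "{2..6::nat} = {2,3,4,5,6}" "{3..6::nat} = {3,4,5,6}"
    "{4..6::nat} = {4,5,6}" "{5..6::nat} = {5,6}"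
    by auto
  have "B v w = (\<Sum>j = 1..6. \<Sum>k = 1..6::nat. \<theta> j v * (\<theta> k w * B (E j) (E k)))"
  proof -
    have "B (E j) w = (\<Sum>k = 1..6. \<theta> k w * B (E j) (E k))" for j
      by (subst E[of w]) (simp add: linear_sum[OF lin(2)] linear_scale[OF lin(2)])
    moreover have "B v w = (\<Sum>j = 1..6. \<theta> j v * B (E j) w)"
      by (subst E[of v]) (simp add: linear_sum[OF lin(1)] linear_scale[OF lin(1)])
    ultimately show ?thesis by (simp add: sum_distrib_left)
  qed
  moreover have d: "B (E j) (E j) = 0" for j using alt[of "E j" "E j"] by simp
  moreover have a: "B (E j) (E k) = - B (E k) (E j)" if "k < j" for j k by (rule alt)
  ultimately show ?thesis
    by (simp add: I wedge_def d a[of 1] a[of 2] a[of 3] a[of 4] a[of 5] a[of 6] algebra_simps del: One_nat_def)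
qed

section \<open>Coordinates of vector-valued functions\<close>

lemma exhaust_6:
  fixes x :: 6
  shows "x = 1 \<or> x = 2 \<or> x = 3 \<or> x = 4 \<or> x = 5 \<or> x = 6"
proof (induct x)
  case (of_int z)
  then have "z = 0 \<or> z = 1 \<or> z = 2 \<or> z = 3 \<or> z = 4 \<or> z = 5" by fastforce
  then show ?case by auto
qed

lemma exhaust_10:
  fixes x :: 10
  shows "x = 1 \<or> x = 2 \<or> x = 3 \<or> x = 4 \<or> x = 5 \<or> x = 6 \<or> x = 7 \<or> x = 8 \<or> x = 9 \<or> x = 10"
proof (induct x)
  case (of_int z)
  then have "0 \<le> z" "z < 10" by simp_all
  then have "z = 0 \<or> z = 1 \<or> z = 2 \<or> z = 3 \<or> z = 4 \<or> z = 5 \<or> z = 6 \<or> z = 7 \<or> z = 8 \<or> z = 9"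
    by presburger
  then show ?case by auto
qed

lemma vec_nth_has_derivative: "((\<lambda>y::real^'n. y $ i) has_derivative (\<lambda>v. v $ i)) (at z)"
  by (intro bounded_linear_imp_has_derivative bounded_linear_vec_nth)

lemma vec_nth_differentiable:
  fixes g :: "'m::real_normed_vector \<Rightarrow> real^'n"
  assumes "g differentiable at z"
  shows "(\<lambda>y. g y $ \<kappa>) differentiable at z"
  using differentiable_chain_at[OF assms differentiableI[OF vec_nth_has_derivative]] by (simp add: o_def)

lemma vec_differentiable:
  fixes g :: "'m::real_normed_vector \<Rightarrow> real^'n"
  assumes "\<And>\<kappa>. (\<lambda>y. g y $ \<kappa>) differentiable at z"
  shows "g differentiable at z"
proof -
  have "(\<lambda>y. \<Sum>\<kappa>\<in>UNIV. g y $ \<kappa> *\<^sub>R (axis \<kappa> 1 :: real^'n)) differentiable at z"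
    by (intro differentiable_sum ballI differentiable_scaleR assms differentiable_const) simp
  moreover have "(\<lambda>y. \<Sum>\<kappa>\<in>UNIV. g y $ \<kappa> *\<^sub>R (axis \<kappa> 1 :: real^'n)) = g"
    using basis_expansion[where 'a = real and 'n = 'n] by (simp add: scalar_mult_eq_scaleR fun_eq_iff)
  ultimately show ?thesis by simp
qed

section \<open>The initial coframe\<close>

lemma real_analytic_on_has_derivative_vec_nth:
  fixes z :: "real^6"
  assumes "real_analytic_on h U" "z $ 1 \<in> U"
  shows "((\<lambda>y. h (y $ 1)) has_derivative (\<lambda>v. deriv h (z $ 1) * v $ 1)) (at z)"
proof -
  have "(h has_real_derivative deriv h (z $ 1)) (at (z $ 1))"
    using real_analytic_on_differentiable[OF assms] by (simp add: DERIV_deriv_iff_real_differentiable)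
  then have "(h has_derivative (*) (deriv h (z $ 1))) (at (z $ 1))"
    by (simp add: has_field_derivative_def)
  with vec_nth_has_derivative show ?thesis by (rule has_derivative_compose)
qed

locale jet_space_operator =
  fixes f :: "nat \<Rightarrow> real \<Rightarrow> real" and U :: "real set"
  assumes open_U: "open U" and analytic: "i \<le> 4 \<Longrightarrow> real_analytic_on (f i) U"
begin

abbreviation "J \<equiv> jet_domain f U"

lemma coeff_has_derivative:
  fixes z :: "real^6"
  assumes "z $ 1 \<in> U" "i \<le> 4"
  shows "((\<lambda>y. f i (y $ 1)) has_derivative (\<lambda>v. deriv (f i) (z $ 1) * v $ 1)) (at z)"
    and "((\<lambda>y. deriv (f i) (y $ 1)) has_derivative (\<lambda>v. (deriv ^^ 2) (f i) (z $ 1) * v $ 1)) (at z)"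
  using real_analytic_on_has_derivative_vec_nth[OF analytic[OF assms(2)] assms(1)]
    real_analytic_on_has_derivative_vec_nth[OF real_analytic_on_deriv[OF analytic[OF assms(2)]] assms(1)]
  by (simp_all add: eval_nat_numeral)

lemma open_J: "open J"
proof -
  have V: "open {z::real^6. z $ 1 \<in> U}"
    using open_vimage_vec_nth[OF open_U] by (simp add: vimage_def)
  have 2: "isCont (\<lambda>y::real^6. f 4 (y $ 1)) z" if "z $ 1 \<in> U" for z :: "real^6"
    using coeff_has_derivative(1)[OF that, of 4] has_derivative_continuous by auto
  have "continuous_on {z::real^6. z $ 1 \<in> U} (\<lambda>z. z $ 2 * f 4 (z $ 1))"
    by (intro continuous_at_imp_continuous_on ballI continuous_intros 2) auto
  from continuous_open_preimage[OF this V, of "- {0}"]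
  have "open ({z::real^6. z $ 1 \<in> U} \<inter> (\<lambda>z. z $ 2 * f 4 (z $ 1)) -` (- {0}))"
    by (simp add: open_Compl)
  moreover have "{z::real^6. z $ 1 \<in> U} \<inter> (\<lambda>z. z $ 2 * f 4 (z $ 1)) -` (- {0}) = J"
    by (auto simp: jet_domain_def)
  ultimately show ?thesis by simp
qed

lemma J_D: "z \<in> J \<Longrightarrow> z $ 1 \<in> U" "z \<in> J \<Longrightarrow> z $ 2 \<noteq> 0" "z \<in> J \<Longrightarrow> f 4 (z $ 1) \<noteq> 0"
  by (auto simp: jet_domain_def)

lemma d_jet_operator:
  assumes "z \<in> J"
  shows "d_fun (jet_operator f) z v =
    f 4 (z $ 1) * v $ 6 + f 3 (z $ 1) * v $ 5 + f 2 (z $ 1) * v $ 4 + f 1 (z $ 1) * v $ 3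
    + f 0 (z $ 1) * v $ 2
    + (deriv (f 4) (z $ 1) * z $ 6 + deriv (f 3) (z $ 1) * z $ 5 + deriv (f 2) (z $ 1) * z $ 4
       + deriv (f 1) (z $ 1) * z $ 3 + deriv (f 0) (z $ 1) * z $ 2) * v $ 1"
  by (subst d_fun_eqI[where h = "jet_operator f"], unfold jet_operator_def,
      (rule derivative_eq_intros coeff_has_derivative(1)[OF J_D(1)[OF assms]] vec_nth_has_derivative refl | simp)+)
    (simp add: algebra_simps)

text \<open>The derivative is symmetric in \<open>v\<close> and \<open>w\<close>, as \<open>\<omega>\<^sup>6\<close> is a differential; hence \<open>d\<omega>\<^sup>6 = 0\<close>.\<close>
lemma omega6_has_derivative:
  assumes "z \<in> J"
  shows "((\<lambda>y. omega f 6 y w) has_derivative (\<lambda>v.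
    deriv (f 4) (z $ 1) * (v $ 1 * w $ 6 + w $ 1 * v $ 6)
    + deriv (f 3) (z $ 1) * (v $ 1 * w $ 5 + w $ 1 * v $ 5)
    + deriv (f 2) (z $ 1) * (v $ 1 * w $ 4 + w $ 1 * v $ 4)
    + deriv (f 1) (z $ 1) * (v $ 1 * w $ 3 + w $ 1 * v $ 3)
    + deriv (f 0) (z $ 1) * (v $ 1 * w $ 2 + w $ 1 * v $ 2)
    + ((deriv ^^ 2) (f 4) (z $ 1) * z $ 6 + (deriv ^^ 2) (f 3) (z $ 1) * z $ 5
       + (deriv ^^ 2) (f 2) (z $ 1) * z $ 4 + (deriv ^^ 2) (f 1) (z $ 1) * z $ 3
       + (deriv ^^ 2) (f 0) (z $ 1) * z $ 2) * v $ 1 * w $ 1)) (at z)"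
proof -
  note D = coeff_has_derivative(1)[OF J_D(1)[OF assms]] coeff_has_derivative(2)[OF J_D(1)[OF assms]]
  show ?thesis
    by (rule has_derivative_transform_within_open[OF _ open_J assms, where f = "\<lambda>y.
    f 4 (y $ 1) * w $ 6 + f 3 (y $ 1) * w $ 5 + f 2 (y $ 1) * w $ 4 + f 1 (y $ 1) * w $ 3
    + f 0 (y $ 1) * w $ 2
    + (deriv (f 4) (y $ 1) * y $ 6 + deriv (f 3) (y $ 1) * y $ 5 + deriv (f 2) (y $ 1) * y $ 4
       + deriv (f 1) (y $ 1) * y $ 3 + deriv (f 0) (y $ 1) * y $ 2) * w $ 1"])
      ((rule derivative_eq_intros D vec_nth_has_derivative refl | simp)+,
       simp add: algebra_simps, simp add: omega_def d_jet_operator)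
qed

lemma omega_has_derivative:
  assumes "z \<in> J"
  shows "((\<lambda>y. omega f 1 y w) has_derivative (\<lambda>v. 0)) (at z)"
    "((\<lambda>y. omega f 2 y w) has_derivative
       (\<lambda>v. - (v $ 3 * w $ 1) / z $ 2 - v $ 2 * (w $ 2 - z $ 3 * w $ 1) / (z $ 2)\<^sup>2)) (at z)"
    "((\<lambda>y. omega f 3 y w) has_derivative (\<lambda>v. - (v $ 4 * w $ 1))) (at z)"
    "((\<lambda>y. omega f 4 y w) has_derivative (\<lambda>v. - (v $ 5 * w $ 1))) (at z)"
    "((\<lambda>y. omega f 5 y w) has_derivative (\<lambda>v. - (v $ 6 * w $ 1))) (at z)"
  unfolding omega_def using J_D(2)[OF assms]
  by (auto intro!: derivative_eq_intros vec_nth_has_derivative simp: field_simps power2_eq_square)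

lemma omega_differentiable:
  assumes "z \<in> J"
  shows "(\<lambda>y. omega f i y w) differentiable at z"
proof -
  consider "i = 1" | "i = 2" | "i = 3" | "i = 4" | "i = 5" | "i \<notin> {1..5}" by force
  then show ?thesis
  proof cases
    case 6
    then have "omega f i = omega f 6" by (auto simp: omega_def fun_eq_iff)
    then show ?thesis using omega6_has_derivative[OF assms] by (auto simp: differentiable_def)
  qed (simp_all only: omega_has_derivative[OF assms, THEN differentiableI])
qed

text \<open>The equation for \<open>\<omega>\<^sup>5\<close> is \<open>d\<omega>\<^sup>5 = dx \<and> ds\<close> with \<open>ds\<close> expressed by the coframe. Solving the
  definition of \<open>\<omega>\<^sup>6\<close> for \<open>ds\<close> brings in the coefficients of the operator and the denominator \<open>f\<^sub>4\<close>.\<close>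
lemma ext_d_omega:
  assumes "z \<in> J"
  shows "ext_d (omega f 1) z v w = 0"
    "ext_d (omega f 2) z v w = wedge (omega f 1 z) (omega f 3 z) v w / z $ 2
       - z $ 3 / z $ 2 * wedge (omega f 1 z) (omega f 2 z) v w"
    "ext_d (omega f 3) z v w = wedge (omega f 1 z) (omega f 4 z) v w"
    "ext_d (omega f 4) z v w = wedge (omega f 1 z) (omega f 5 z) v w"
    "ext_d (omega f 5) z v w = (wedge (omega f 1 z) (omega f 6 z) v w
       - f 3 (z $ 1) * wedge (omega f 1 z) (omega f 5 z) v w
       - f 2 (z $ 1) * wedge (omega f 1 z) (omega f 4 z) v w
       - f 1 (z $ 1) * wedge (omega f 1 z) (omega f 3 z) v w
       - f 0 (z $ 1) * z $ 2 * wedge (omega f 1 z) (omega f 2 z) v w) / f 4 (z $ 1)"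
    "ext_d (omega f 6) z v w = 0"
proof -
  note J = J_D(2,3)[OF assms]
  note [simp] = wedge_def
  show "ext_d (omega f 1) z v w = 0"
    by (subst ext_d_eqI[where \<alpha> = "omega f 1", OF omega_has_derivative(1)[OF assms]]) simp
  show "ext_d (omega f 2) z v w = wedge (omega f 1 z) (omega f 3 z) v w / z $ 2
       - z $ 3 / z $ 2 * wedge (omega f 1 z) (omega f 2 z) v w"
    using J by (subst ext_d_eqI[where \<alpha> = "omega f 2", OF omega_has_derivative(2)[OF assms]])
      (simp add: omega_def field_simps power2_eq_square)
  show "ext_d (omega f 3) z v w = wedge (omega f 1 z) (omega f 4 z) v w"
    by (subst ext_d_eqI[where \<alpha> = "omega f 3", OF omega_has_derivative(3)[OF assms]])
      (simp add: omega_def algebra_simps)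
  show "ext_d (omega f 4) z v w = wedge (omega f 1 z) (omega f 5 z) v w"
    by (subst ext_d_eqI[where \<alpha> = "omega f 4", OF omega_has_derivative(4)[OF assms]])
      (simp add: omega_def algebra_simps)
  have u: "z $ 2 * omega f 2 z x = x $ 2 - z $ 3 * x $ 1" for x
    using J by (simp add: omega_def)
  have "wedge (omega f 1 z) (omega f 6 z) v w
       - f 3 (z $ 1) * wedge (omega f 1 z) (omega f 5 z) v w
       - f 2 (z $ 1) * wedge (omega f 1 z) (omega f 4 z) v w
       - f 1 (z $ 1) * wedge (omega f 1 z) (omega f 3 z) v w
       - f 0 (z $ 1) * (v $ 1 * (z $ 2 * omega f 2 z w) - w $ 1 * (z $ 2 * omega f 2 z v))
    = f 4 (z $ 1) * (v $ 1 * w $ 6 - w $ 1 * v $ 6)"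
    unfolding u by (simp add: omega_def d_jet_operator[OF assms] algebra_simps)
  moreover have "ext_d (omega f 5) z v w = v $ 1 * w $ 6 - w $ 1 * v $ 6"
    by (subst ext_d_eqI[where \<alpha> = "omega f 5", OF omega_has_derivative(5)[OF assms]]) simp
  moreover have "f 0 (z $ 1) * (v $ 1 * (z $ 2 * omega f 2 z w) - w $ 1 * (z $ 2 * omega f 2 z v))
    = f 0 (z $ 1) * z $ 2 * wedge (omega f 1 z) (omega f 2 z) v w"
    by (simp add: omega_def algebra_simps)
  ultimately show "ext_d (omega f 5) z v w = (wedge (omega f 1 z) (omega f 6 z) v w
       - f 3 (z $ 1) * wedge (omega f 1 z) (omega f 5 z) v w
       - f 2 (z $ 1) * wedge (omega f 1 z) (omega f 4 z) v w
       - f 1 (z $ 1) * wedge (omega f 1 z) (omega f 3 z) v w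
       - f 0 (z $ 1) * z $ 2 * wedge (omega f 1 z) (omega f 2 z) v w) / f 4 (z $ 1)"
    using J by simp
  show "ext_d (omega f 6) z v w = 0"
    by (subst ext_d_eqI[where \<alpha> = "omega f 6", OF omega6_has_derivative[OF assms]])
      (simp add: algebra_simps)
qed

lemma linear_omega:
  assumes "z \<in> J"
  shows "linear (omega f i z)"
  unfolding omega_def using J_D(2)[OF assms]
  by (auto intro!: linearI simp: d_jet_operator[OF assms] algebra_simps diff_divide_distrib add_divide_distrib)

end

section \<open>Coframes along a section of the structure group\<close>

lemma reduced_coframe_simps:
  "reduced_coframe f \<sigma> 1 = (\<lambda>z v. \<sigma> z $ 1 * omega f 1 z v)"
  "reduced_coframe f \<sigma> 2 = omega f 2"
  "reduced_coframe f \<sigma> 3 = (\<lambda>z v. \<sigma> z $ 2 * omega f 2 z v + \<sigma> z $ 3 * omega f 3 z v)"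
  "reduced_coframe f \<sigma> 4 = (\<lambda>z v. \<sigma> z $ 4 * omega f 2 z v + \<sigma> z $ 5 * omega f 3 z v
     + \<sigma> z $ 6 * omega f 4 z v)"
  "reduced_coframe f \<sigma> 5 = (\<lambda>z v. \<sigma> z $ 7 * omega f 2 z v + \<sigma> z $ 8 * omega f 3 z v
     + \<sigma> z $ 9 * omega f 4 z v + \<sigma> z $ 10 * omega f 5 z v)"
  "reduced_coframe f \<sigma> 6 = omega f 6"
  by (simp_all add: reduced_coframe_def group_act_def)

context jet_space_operator
begin

lemma linear_reduced_coframe:
  assumes "z \<in> J"
  shows "linear (reduced_coframe f \<tau> i z)"
  unfolding reduced_coframe_def group_act_def
  by (auto intro!: linearI simp: linear_add[OF linear_omega[OF assms]]
      linear_scale[OF linear_omega[OF assms]] algebra_simps)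

lemma reduced_coframe_differentiable:
  assumes "z \<in> J" "\<tau> differentiable at z"
  shows "(\<lambda>y. reduced_coframe f \<tau> i y v) differentiable at z"
proof -
  note D = vec_nth_differentiable[OF assms(2)] omega_differentiable[OF assms(1)]
  show ?thesis unfolding reduced_coframe_def group_act_def
    by (cases "i = 1"; cases "i = 2"; cases "i = 3"; cases "i = 4"; cases "i = 5")
      (simp_all add: D differentiable_add differentiable_mult del: One_nat_def)
qed

lemma ext_d_reduced_coframe:
  assumes "z \<in> J" "\<tau> differentiable at z"
  defines "d \<equiv> \<lambda>\<kappa>. d_fun (\<lambda>y. \<tau> y $ \<kappa>) z"
  shows "ext_d (reduced_coframe f \<tau> 3) z v w =
      wedge (d 2) (omega f 2 z) v w + \<tau> z $ 2 * ext_d (omega f 2) z v w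
      + (wedge (d 3) (omega f 3 z) v w + \<tau> z $ 3 * ext_d (omega f 3) z v w)"
    "ext_d (reduced_coframe f \<tau> 4) z v w =
      wedge (d 4) (omega f 2 z) v w + \<tau> z $ 4 * ext_d (omega f 2) z v w
      + (wedge (d 5) (omega f 3 z) v w + \<tau> z $ 5 * ext_d (omega f 3) z v w)
      + (wedge (d 6) (omega f 4 z) v w + \<tau> z $ 6 * ext_d (omega f 4) z v w)"
    "ext_d (reduced_coframe f \<tau> 5) z v w =
      wedge (d 7) (omega f 2 z) v w + \<tau> z $ 7 * ext_d (omega f 2) z v w
      + (wedge (d 8) (omega f 3 z) v w + \<tau> z $ 8 * ext_d (omega f 3) z v w)
      + (wedge (d 9) (omega f 4 z) v w + \<tau> z $ 9 * ext_d (omega f 4) z v w)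
      + (wedge (d 10) (omega f 5 z) v w + \<tau> z $ 10 * ext_d (omega f 5) z v w)"
proof -
  note D = vec_nth_differentiable[OF assms(2)]
  note M = ext_d_mult[OF D omega_differentiable[OF assms(1)]]
  have D': "(\<lambda>y. \<tau> y $ \<kappa> * omega f i y v) differentiable at z" for \<kappa> i v
    by (intro differentiable_mult D omega_differentiable[OF assms(1)])
  note A = ext_d_add[OF D' D'] ext_d_add[OF differentiable_add[OF D' D'] D']
    ext_d_add[OF differentiable_add[OF differentiable_add[OF D' D'] D'] D']
  show "ext_d (reduced_coframe f \<tau> 3) z v w =
      wedge (d 2) (omega f 2 z) v w + \<tau> z $ 2 * ext_d (omega f 2) z v w
      + (wedge (d 3) (omega f 3 z) v w + \<tau> z $ 3 * ext_d (omega f 3) z v w)"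
    unfolding reduced_coframe_simps A M d_def ..
  show "ext_d (reduced_coframe f \<tau> 4) z v w =
      wedge (d 4) (omega f 2 z) v w + \<tau> z $ 4 * ext_d (omega f 2) z v w
      + (wedge (d 5) (omega f 3 z) v w + \<tau> z $ 5 * ext_d (omega f 3) z v w)
      + (wedge (d 6) (omega f 4 z) v w + \<tau> z $ 6 * ext_d (omega f 4) z v w)"
    unfolding reduced_coframe_simps A M d_def ..
  show "ext_d (reduced_coframe f \<tau> 5) z v w =
      wedge (d 7) (omega f 2 z) v w + \<tau> z $ 7 * ext_d (omega f 2) z v w
      + (wedge (d 8) (omega f 3 z) v w + \<tau> z $ 8 * ext_d (omega f 3) z v w)
      + (wedge (d 9) (omega f 4 z) v w + \<tau> z $ 9 * ext_d (omega f 4) z v w)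
      + (wedge (d 10) (omega f 5 z) v w + \<tau> z $ 10 * ext_d (omega f 5) z v w)"
    unfolding reduced_coframe_simps A M d_def ..
qed

end

section \<open>Ratios of jet coordinates\<close>

text \<open>The common scale \<open>b\<close> of the normalized diagonal parameters: \<open>a\<^sub>1 = 1/b\<close>, and \<open>a\<^sub>3, a\<^sub>6, a\<^sub>1\<^sub>0\<close> are
  \<open>b, b\<^sup>2, b\<^sup>3\<close> divided by \<open>u\<close>.\<close>
definition weight :: "(nat \<Rightarrow> real \<Rightarrow> real) \<Rightarrow> real^6 \<Rightarrow> real" where
  "weight f z = root 4 (f 4 (z $ 1) * z $ 2)"

text \<open>\<open>P, Q, R, S\<close> are \<open>jet_ratio i\<close> for \<open>i = 3, 4, 5, 6\<close>.\<close>
definition jet_ratio :: "6 \<Rightarrow> real^6 \<Rightarrow> real" where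
  "jet_ratio i z = z $ i / z $ 2"

definition coeff_ratio :: "(nat \<Rightarrow> real \<Rightarrow> real) \<Rightarrow> nat \<Rightarrow> nat \<Rightarrow> real^6 \<Rightarrow> real" where
  "coeff_ratio f i n z = (deriv ^^ n) (f i) (z $ 1) / f 4 (z $ 1)"

text \<open>The form \<open>(\<omega>\<^sup>i - p \<omega>\<^sup>2)/u\<close> for \<open>i = 3\<close>, with \<open>q\<close> or \<open>r\<close> in place of \<open>p\<close> for \<open>i = 4, 5\<close>. It is the
  contact form \<open>\<zeta>\<^sup>i\<close> of the ratio \<open>P\<close>, \<open>Q\<close> or \<open>R\<close>, as the derivatives of these ratios below show.\<close>
definition ratio_form :: "(nat \<Rightarrow> real \<Rightarrow> real) \<Rightarrow> nat \<Rightarrow> (real^6) form1" where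
  "ratio_form f i = (\<lambda>z v. (omega f i z v
     - (if i = 3 then z $ 3 else if i = 4 then z $ 4 else z $ 5) * omega f 2 z v) / z $ 2)"

context jet_space_operator
begin

lemma u_direction:
  assumes "z $ 2 \<noteq> 0"
  shows "v $ 2 = z $ 2 * (omega f 2 z v + jet_ratio 3 z * omega f 1 z v)"
  using assms by (simp add: omega_def jet_ratio_def field_simps)

lemma inverse_u_has_derivative:
  assumes "z \<in> J"
  shows "((\<lambda>y. 1 / y $ 2) has_derivative
    (\<lambda>v. - (omega f 2 z v + jet_ratio 3 z * omega f 1 z v) / z $ 2)) (at z)"
proof -
  have e: "- (z $ 2 * x) / (z $ 2)^2 = - x / z $ 2" for x
    using J_D(2)[OF assms] by (simp add: power2_eq_square)
  have "((\<lambda>y. 1 / y $ 2) has_derivative (\<lambda>v. - (v $ 2) / (z $ 2)^2)) (at z)"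
    using J_D(2)[OF assms]
    by (auto intro!: derivative_eq_intros vec_nth_has_derivative simp: power2_eq_square)
  also have "(\<lambda>v. - (v $ 2) / (z $ 2)^2)
    = (\<lambda>v. - (omega f 2 z v + jet_ratio 3 z * omega f 1 z v) / z $ 2)"
    by (subst u_direction[OF J_D(2)[OF assms]]) (simp only: e)
  finally show ?thesis .
qed

lemma jet_ratio_has_derivative:
  assumes "z \<in> J"
  shows "(jet_ratio 3 has_derivative (\<lambda>v. ratio_form f 3 z v
      + (jet_ratio 4 z - (jet_ratio 3 z)^2) * omega f 1 z v)) (at z)"
    "(jet_ratio 4 has_derivative (\<lambda>v. ratio_form f 4 z v
      + (jet_ratio 5 z - jet_ratio 3 z * jet_ratio 4 z) * omega f 1 z v)) (at z)"
    "(jet_ratio 5 has_derivative (\<lambda>v. ratio_form f 5 z v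
      + (jet_ratio 6 z - jet_ratio 3 z * jet_ratio 5 z) * omega f 1 z v)) (at z)"
proof -
  have D: "(jet_ratio i has_derivative (\<lambda>v. v $ i / z $ 2
    - jet_ratio i z * (omega f 2 z v + jet_ratio 3 z * omega f 1 z v))) (at z)" for i
  proof -
    have "((\<lambda>y. y $ i * (1 / y $ 2)) has_derivative (\<lambda>v. z $ i *
      (- (omega f 2 z v + jet_ratio 3 z * omega f 1 z v) / z $ 2) + v $ i * (1 / z $ 2))) (at z)"
      by (intro has_derivative_mult inverse_u_has_derivative[OF assms] vec_nth_has_derivative)
    moreover have "(\<lambda>v. z $ i * (- (omega f 2 z v + jet_ratio 3 z * omega f 1 z v) / z $ 2)
        + v $ i * (1 / z $ 2))
      = (\<lambda>v. v $ i / z $ 2 - z $ i / z $ 2 * (omega f 2 z v + jet_ratio 3 z * omega f 1 z v))"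
      by (simp add: fun_eq_iff diff_divide_distrib add_divide_distrib algebra_simps)
    ultimately show ?thesis unfolding jet_ratio_def[abs_def] by (simp only: mult_1_right times_divide_eq_right)
  qed
  have o: "omega f 3 z v = v $ 3 - z $ 4 * v $ 1" "omega f 4 z v = v $ 4 - z $ 5 * v $ 1"
    "omega f 5 z v = v $ 5 - z $ 6 * v $ 1" "omega f 1 z v = v $ 1" for v
    by (simp_all add: omega_def)
  have R: "a / c - P * (w + Q * x) = (a - b * x - d * w) / c + (b / c - Q * P) * x"
    if "P = d / c" for a b c d w x P Q :: real
    using that by (simp add: algebra_simps diff_divide_distrib add_divide_distrib)
  show "(jet_ratio 3 has_derivative (\<lambda>v. ratio_form f 3 z v
      + (jet_ratio 4 z - (jet_ratio 3 z)^2) * omega f 1 z v)) (at z)"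
    by (rule has_derivative_eq_rhs[OF D], rule ext, subst R[where b = "z $ 4" and d = "z $ 3"])
      (simp_all add: ratio_form_def o jet_ratio_def[of 3] jet_ratio_def[of 4] power2_eq_square del: One_nat_def)
  show "(jet_ratio 4 has_derivative (\<lambda>v. ratio_form f 4 z v
      + (jet_ratio 5 z - jet_ratio 3 z * jet_ratio 4 z) * omega f 1 z v)) (at z)"
    by (rule has_derivative_eq_rhs[OF D], rule ext, subst R[where b = "z $ 5" and d = "z $ 4"])
      (simp_all add: ratio_form_def o jet_ratio_def[of 4] jet_ratio_def[of 5] del: One_nat_def)
  show "(jet_ratio 5 has_derivative (\<lambda>v. ratio_form f 5 z v
      + (jet_ratio 6 z - jet_ratio 3 z * jet_ratio 5 z) * omega f 1 z v)) (at z)"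
    by (rule has_derivative_eq_rhs[OF D], rule ext, subst R[where b = "z $ 6" and d = "z $ 5"])
      (simp_all add: ratio_form_def o jet_ratio_def[of 5] jet_ratio_def[of 6] del: One_nat_def)
qed

lemma coeff_ratio_has_derivative:
  assumes "z \<in> J" "i \<le> 4"
  shows "(coeff_ratio f i n has_derivative (\<lambda>v. (coeff_ratio f i (Suc n) z
    - coeff_ratio f i n z * coeff_ratio f 4 1 z) * omega f 1 z v)) (at z)"
proof -
  have 1: "((\<lambda>y::real^6. (deriv ^^ n) (f i) (y $ 1)) has_derivative
      (\<lambda>v. (deriv ^^ Suc n) (f i) (z $ 1) * v $ 1)) (at z)"
    using real_analytic_on_has_derivative_vec_nth[OF real_analytic_on_higher_deriv[OF analytic[OF assms(2)]] J_D(1)[OF assms(1)]]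
    by simp
  note 2 = coeff_has_derivative(1)[OF J_D(1)[OF assms(1)], of 4, simplified]
  have "((\<lambda>y. (deriv ^^ n) (f i) (y $ 1) / f 4 (y $ 1)) has_derivative
     (\<lambda>v. - (deriv ^^ n) (f i) (z $ 1) *
       (inverse (f 4 (z $ 1)) * (deriv (f 4) (z $ 1) * v $ 1) * inverse (f 4 (z $ 1)))
       + (deriv ^^ Suc n) (f i) (z $ 1) * v $ 1 / f 4 (z $ 1))) (at z)"
    by (rule has_derivative_divide[OF 1 2]) (use J_D[OF assms(1)] in auto)
  then show ?thesis
    using J_D[OF assms(1)]
    by (simp add: coeff_ratio_def[abs_def] omega_def field_simps)
qed

lemma weight_power4:
  assumes "f 4 (z $ 1) * z $ 2 > 0"
  shows "weight f z > 0" "(weight f z)^4 = f 4 (z $ 1) * z $ 2"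
  using assms by (simp_all add: weight_def)

text \<open>Logarithmic differentiation of \<open>b\<^sup>4 = f\<^sub>4 u\<close> with \<open>du/u = \<omega>\<^sup>2 + P dx\<close>.\<close>
lemma weight_has_derivative:
  assumes "z \<in> J" "f 4 (z $ 1) * z $ 2 > 0"
  shows "(weight f has_derivative (\<lambda>v. weight f z / 4 *
    ((coeff_ratio f 4 1 z + jet_ratio 3 z) * omega f 1 z v + omega f 2 z v))) (at z)"
proof -
  note D = coeff_has_derivative(1)[OF J_D(1)[OF assms(1)], of 4, simplified]
  let ?m = "f 4 (z $ 1) * z $ 2"
  have 1: "((\<lambda>y. f 4 (y $ 1) * y $ 2) has_derivative
      (\<lambda>v. f 4 (z $ 1) * v $ 2 + deriv (f 4) (z $ 1) * v $ 1 * z $ 2)) (at z)"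
    by (intro has_derivative_mult D vec_nth_has_derivative)
  have 2: "(root 4 has_derivative (*) (inverse (real 4 * root 4 ?m ^ (4 - Suc 0)))) (at ?m)"
    using DERIV_real_root[of 4 ?m] assms(2) by (simp add: has_field_derivative_def)
  have 3: "(weight f has_derivative (\<lambda>v. inverse (4 * (weight f z)^3) *
      (f 4 (z $ 1) * v $ 2 + deriv (f 4) (z $ 1) * v $ 1 * z $ 2))) (at z)"
    using has_derivative_compose[OF 1 2] by (simp add: weight_def[abs_def])
  have w: "weight f z \<noteq> 0" using weight_power4[OF assms(2)] by simp
  have "inverse (4 * (weight f z)^3) * x = weight f z / 4 * (x / ?m)" for x
    unfolding weight_power4(2)[OF assms(2), symmetric] using w by (simp add: field_simps eval_nat_numeral)
  moreover have "(f 4 (z $ 1) * v $ 2 + deriv (f 4) (z $ 1) * v $ 1 * z $ 2) / ?m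
    = (coeff_ratio f 4 1 z + jet_ratio 3 z) * omega f 1 z v + omega f 2 z v" for v
    using J_D[OF assms(1)] by (simp add: coeff_ratio_def jet_ratio_def omega_def field_simps)
  ultimately show ?thesis using 3 by (simp only:)
qed

lemma ratio_form_differentiable:
  assumes "z \<in> J"
  shows "(\<lambda>y. ratio_form f i y v) differentiable at z"
proof -
  have "(\<lambda>y. y $ j) differentiable at z" for j using vec_nth_has_derivative differentiableI by blast
  then show ?thesis
    unfolding ratio_form_def using J_D(2)[OF assms] omega_differentiable[OF assms]
    by (cases "i = 3"; cases "i = 4")
      (simp_all add: differentiable_divide differentiable_mult differentiable_diff)
qed

lemma ext_d_omega2_ratio:
  assumes "z \<in> J"
  shows "ext_d (omega f 2) z v w = wedge (omega f 1 z) (ratio_form f 3 z) v w"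
  using J_D[OF assms] by (simp add: ext_d_omega[OF assms] ratio_form_def wedge_def field_simps)

lemma ext_d_quotient_by_u:
  assumes "z \<in> J"
  shows "ext_d (\<lambda>y v. 1 / y $ 2 * omega f i y v + (- jet_ratio j y) * omega f 2 y v) z v w
    = wedge (d_fun (\<lambda>y. 1 / y $ 2) z) (omega f i z) v w + 1 / z $ 2 * ext_d (omega f i) z v w
      + (wedge (d_fun (\<lambda>y. - jet_ratio j y) z) (omega f 2 z) v w - jet_ratio j z * ext_d (omega f 2) z v w)"
proof -
  have n: "(\<lambda>y. y $ k) differentiable at z" for k using vec_nth_has_derivative differentiableI by blast
  have 1: "(\<lambda>y. 1 / y $ 2) differentiable at z"
    using inverse_u_has_derivative[OF assms] differentiableI by blast
  have 2: "(\<lambda>y. - jet_ratio j y) differentiable at z"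
    unfolding jet_ratio_def by (intro derivative_intros differentiable_divide n J_D(2)[OF assms])
  show ?thesis
    by (subst ext_d_add, (intro differentiable_mult 1 2 omega_differentiable[OF assms])+,
        subst ext_d_mult[OF 1 omega_differentiable[OF assms]],
        subst ext_d_mult[OF 2 omega_differentiable[OF assms]], simp)
qed

text \<open>Differentiating \<open>dP = \<zeta>\<^sup>3 + (Q - P\<^sup>2) dx\<close> and its analogues for \<open>Q\<close> and \<open>R\<close> shows that \<open>d\<zeta>\<^sup>i\<close> is
  \<open>dx\<close> wedge the differential of the coefficient of \<open>dx\<close>. For \<open>\<zeta>\<^sup>5\<close> this involves \<open>dS\<close>, which
  \<open>\<omega>\<^sup>6\<close>, the differential of \<open>b\<^sup>4(S + f\<^sub>3/f\<^sub>4 R + \<dots> + f\<^sub>0/f\<^sub>4)\<close>, expresses by the other forms.\<close>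
lemma ext_d_ratio_form:
  assumes "z \<in> J" "f 4 (z $ 1) * z $ 2 > 0"
  shows "ext_d (ratio_form f 3) z v w = wedge (omega f 1 z) (ratio_form f 4 z) v w
      - 2 * jet_ratio 3 z * wedge (omega f 1 z) (ratio_form f 3 z) v w"
    "ext_d (ratio_form f 4) z v w = wedge (omega f 1 z) (ratio_form f 5 z) v w
      - jet_ratio 3 z * wedge (omega f 1 z) (ratio_form f 4 z) v w
      - jet_ratio 4 z * wedge (omega f 1 z) (ratio_form f 3 z) v w"
    "ext_d (ratio_form f 5) z v w = wedge (omega f 1 z) (omega f 6 z) v w / (weight f z)^4
      - (jet_ratio 6 z + coeff_ratio f 3 0 z * jet_ratio 5 z + coeff_ratio f 2 0 z * jet_ratio 4 z
          + coeff_ratio f 1 0 z * jet_ratio 3 z + coeff_ratio f 0 0 z)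
          * wedge (omega f 1 z) (omega f 2 z) v w
      - (coeff_ratio f 3 0 z + jet_ratio 3 z) * wedge (omega f 1 z) (ratio_form f 5 z) v w
      - coeff_ratio f 2 0 z * wedge (omega f 1 z) (ratio_form f 4 z) v w
      - (coeff_ratio f 1 0 z + jet_ratio 5 z) * wedge (omega f 1 z) (ratio_form f 3 z) v w"
proof -
  have form: "ratio_form f 3 = (\<lambda>y v. 1 / y $ 2 * omega f 3 y v + (- jet_ratio 3 y) * omega f 2 y v)"
    "ratio_form f 4 = (\<lambda>y v. 1 / y $ 2 * omega f 4 y v + (- jet_ratio 4 y) * omega f 2 y v)"
    "ratio_form f 5 = (\<lambda>y v. 1 / y $ 2 * omega f 5 y v + (- jet_ratio 5 y) * omega f 2 y v)"
    by (auto simp: ratio_form_def jet_ratio_def diff_divide_distrib fun_eq_iff)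
  have O: "omega f 3 z x = z $ 2 * (ratio_form f 3 z x + jet_ratio 3 z * omega f 2 z x)"
    "omega f 4 z x = z $ 2 * (ratio_form f 4 z x + jet_ratio 4 z * omega f 2 z x)"
    "omega f 5 z x = z $ 2 * (ratio_form f 5 z x + jet_ratio 5 z * omega f 2 z x)" for x
    using J_D[OF assms(1)] by (simp_all add: form jet_ratio_def field_simps)
  have C: "f 3 (z $ 1) = f 4 (z $ 1) * coeff_ratio f 3 0 z" "f 2 (z $ 1) = f 4 (z $ 1) * coeff_ratio f 2 0 z"
     "f 1 (z $ 1) = f 4 (z $ 1) * coeff_ratio f 1 0 z" "f 0 (z $ 1) = f 4 (z $ 1) * coeff_ratio f 0 0 z"
    using J_D[OF assms(1)] by (simp_all add: coeff_ratio_def)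
  note D = d_fun_eqI[OF inverse_u_has_derivative[OF assms(1)]]
    d_fun_eqI[OF has_derivative_minus[OF jet_ratio_has_derivative(1)[OF assms(1)]]]
    d_fun_eqI[OF has_derivative_minus[OF jet_ratio_has_derivative(2)[OF assms(1)]]]
    d_fun_eqI[OF has_derivative_minus[OF jet_ratio_has_derivative(3)[OF assms(1)]]]
  note E = wedge_def ext_d_omega2_ratio[OF assms(1)] D
  have u: "1 / z $ 2 * (a * (z $ 2 * x) - b * (z $ 2 * y)) = a * x - b * y"
    "a / z $ 2 * (z $ 2 * x) = a * x" for a b x y
    using J_D[OF assms(1)] by (simp_all add: field_simps)
  have d: "1 / z $ 2 * ext_d (omega f 3) z v w
      = wedge (omega f 1 z) (\<lambda>x. ratio_form f 4 z x + jet_ratio 4 z * omega f 2 z x) v w"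
    "1 / z $ 2 * ext_d (omega f 4) z v w
      = wedge (omega f 1 z) (\<lambda>x. ratio_form f 5 z x + jet_ratio 5 z * omega f 2 z x) v w"
    unfolding ext_d_omega(3,4)[OF assms(1)] wedge_def O u by simp_all
  have q: "1 / z $ 2 * ((A - m * k * (z $ 2 * B) - m * k' * (z $ 2 * B') - m * k'' * (z $ 2 * B'')
        - m * k0 * z $ 2 * B0) / m) = A / (m * z $ 2) - k * B - k' * B' - k'' * B'' - k0 * B0"
    if "m \<noteq> 0" for A B B' B'' B0 k k' k'' k0 m
    using J_D[OF assms(1)] that by (simp add: diff_divide_distrib)
  have wu: "wedge (omega f 1 z) (\<lambda>x. z $ 2 * \<alpha> x) v w = z $ 2 * wedge (omega f 1 z) \<alpha> v w" for \<alpha>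
    by (simp add: wedge_def algebra_simps)
  have O': "omega f 3 z = (\<lambda>x. z $ 2 * (ratio_form f 3 z x + jet_ratio 3 z * omega f 2 z x))"
    "omega f 4 z = (\<lambda>x. z $ 2 * (ratio_form f 4 z x + jet_ratio 4 z * omega f 2 z x))"
    "omega f 5 z = (\<lambda>x. z $ 2 * (ratio_form f 5 z x + jet_ratio 5 z * omega f 2 z x))"
    using O by blast+
  have d5: "1 / z $ 2 * ext_d (omega f 5) z v w = wedge (omega f 1 z) (omega f 6 z) v w / (weight f z)^4
      - coeff_ratio f 3 0 z
        * wedge (omega f 1 z) (\<lambda>x. ratio_form f 5 z x + jet_ratio 5 z * omega f 2 z x) v w
      - coeff_ratio f 2 0 z
        * wedge (omega f 1 z) (\<lambda>x. ratio_form f 4 z x + jet_ratio 4 z * omega f 2 z x) v w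
      - coeff_ratio f 1 0 z
        * wedge (omega f 1 z) (\<lambda>x. ratio_form f 3 z x + jet_ratio 3 z * omega f 2 z x) v w
      - coeff_ratio f 0 0 z * wedge (omega f 1 z) (omega f 2 z) v w"
    unfolding ext_d_omega(5)[OF assms(1)] C O' wu weight_power4(2)[OF assms(2)]
    by (rule q[OF J_D(3)[OF assms(1)]])
  show "ext_d (ratio_form f 3) z v w = wedge (omega f 1 z) (ratio_form f 4 z) v w
      - 2 * jet_ratio 3 z * wedge (omega f 1 z) (ratio_form f 3 z) v w"
    by (subst form(1), subst ext_d_quotient_by_u[OF assms(1)], simp only: E d O u)
      (simp add: algebra_simps power2_eq_square)
  show "ext_d (ratio_form f 4) z v w = wedge (omega f 1 z) (ratio_form f 5 z) v w
      - jet_ratio 3 z * wedge (omega f 1 z) (ratio_form f 4 z) v w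
      - jet_ratio 4 z * wedge (omega f 1 z) (ratio_form f 3 z) v w"
    by (subst form(2), subst ext_d_quotient_by_u[OF assms(1)], simp only: E d O u)
      (simp add: algebra_simps power2_eq_square)
  show "ext_d (ratio_form f 5) z v w = wedge (omega f 1 z) (omega f 6 z) v w / (weight f z)^4
      - (jet_ratio 6 z + coeff_ratio f 3 0 z * jet_ratio 5 z + coeff_ratio f 2 0 z * jet_ratio 4 z
          + coeff_ratio f 1 0 z * jet_ratio 3 z + coeff_ratio f 0 0 z)
          * wedge (omega f 1 z) (omega f 2 z) v w
      - (coeff_ratio f 3 0 z + jet_ratio 3 z) * wedge (omega f 1 z) (ratio_form f 5 z) v w
      - coeff_ratio f 2 0 z * wedge (omega f 1 z) (ratio_form f 4 z) v w
      - (coeff_ratio f 1 0 z + jet_ratio 5 z) * wedge (omega f 1 z) (ratio_form f 3 z) v w"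
    by (subst form(3), subst ext_d_quotient_by_u[OF assms(1)], simp only: E d5 O u)
      (simp add: algebra_simps)
qed

end

section \<open>The normal section and its structure equations\<close>

text \<open>\<open>mu43\<close> is the coefficient of \<open>\<zeta>\<^sup>3\<close> in \<open>\<theta>\<^sup>4/b\<^sup>2\<close>, and \<open>mu54\<close>, \<open>mu53\<close> are those of \<open>\<zeta>\<^sup>4\<close> and \<open>\<zeta>\<^sup>3\<close> in
  \<open>\<theta>\<^sup>5/b\<^sup>3\<close>. The normalizations \<open>T\<^sup>3\<^sub>1\<^sub>3 = 0\<close>, \<open>T\<^sup>5\<^sub>1\<^sub>5 = 0\<close> and \<open>T\<^sup>4\<^sub>1\<^sub>3 = 0\<close>, in this order, force these values.\<close>
definition mu43 :: "(nat \<Rightarrow> real \<Rightarrow> real) \<Rightarrow> real^6 \<Rightarrow> real" where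
  "mu43 f z = (coeff_ratio f 4 1 z - 7 * jet_ratio 3 z) / 4"

definition mu54 :: "(nat \<Rightarrow> real \<Rightarrow> real) \<Rightarrow> real^6 \<Rightarrow> real" where
  "mu54 f z = (jet_ratio 3 z - 3 * coeff_ratio f 4 1 z + 4 * coeff_ratio f 3 0 z) / 4"

definition mu53 :: "(nat \<Rightarrow> real \<Rightarrow> real) \<Rightarrow> real^6 \<Rightarrow> real" where
  "mu53 f z = (8 * jet_ratio 3 z * coeff_ratio f 4 1 z - 7 * jet_ratio 3 z * coeff_ratio f 3 0 z
     - 11 * jet_ratio 4 z - 2 * (coeff_ratio f 4 1 z)^2
     + coeff_ratio f 4 1 z * coeff_ratio f 3 0 z + coeff_ratio f 4 2 z) / 4"

text \<open>The entries are the coefficients of \<open>\<omega>\<^sup>2, \<dots>, \<omega>\<^sup>5\<close> in the forms \<open>b \<zeta>\<^sup>3\<close>, \<open>b\<^sup>2(\<zeta>\<^sup>4 + \<mu>\<^sub>4\<^sub>3 \<zeta>\<^sup>3)\<close> and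
  \<open>b\<^sup>3(\<zeta>\<^sup>5 + \<mu>\<^sub>5\<^sub>4 \<zeta>\<^sup>4 + \<mu>\<^sub>5\<^sub>3 \<zeta>\<^sup>3)\<close>. That \<open>a\<^sub>2, a\<^sub>4, a\<^sub>7\<close> are determined by the other entries reflects
  that \<open>\<theta>\<^sup>3, \<theta>\<^sup>4, \<theta>\<^sup>5\<close> involve \<open>\<omega>\<^sup>2\<close> only through the \<open>\<zeta>\<^sup>i\<close>.\<close>
definition normal_section :: "(nat \<Rightarrow> real \<Rightarrow> real) \<Rightarrow> real^6 \<Rightarrow> real^10" where
  "normal_section f z = (\<chi> \<kappa>.
     if \<kappa> = 1 then 1 / weight f z
     else if \<kappa> = 2 then - weight f z * jet_ratio 3 z
     else if \<kappa> = 3 then weight f z / z $ 2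
     else if \<kappa> = 4 then - ((weight f z)^2 * (jet_ratio 4 z + mu43 f z * jet_ratio 3 z))
     else if \<kappa> = 5 then (weight f z)^2 * mu43 f z / z $ 2
     else if \<kappa> = 6 then (weight f z)^2 / z $ 2
     else if \<kappa> = 7 then - ((weight f z)^3 *
       (jet_ratio 5 z + mu54 f z * jet_ratio 4 z + mu53 f z * jet_ratio 3 z))
     else if \<kappa> = 8 then (weight f z)^3 * mu53 f z / z $ 2
     else if \<kappa> = 9 then (weight f z)^3 * mu54 f z / z $ 2
     else (weight f z)^3 / z $ 2)"

lemma normal_section_simps:
  "normal_section f z $ 1 = 1 / weight f z"
  "normal_section f z $ 2 = - weight f z * jet_ratio 3 z"
  "normal_section f z $ 3 = weight f z / z $ 2"
  "normal_section f z $ 4 = - ((weight f z)^2 * (jet_ratio 4 z + mu43 f z * jet_ratio 3 z))"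
  "normal_section f z $ 5 = (weight f z)^2 * mu43 f z / z $ 2"
  "normal_section f z $ 6 = (weight f z)^2 / z $ 2"
  "normal_section f z $ 7 = - ((weight f z)^3 *
       (jet_ratio 5 z + mu54 f z * jet_ratio 4 z + mu53 f z * jet_ratio 3 z))"
  "normal_section f z $ 8 = (weight f z)^3 * mu53 f z / z $ 2"
  "normal_section f z $ 9 = (weight f z)^3 * mu54 f z / z $ 2"
  "normal_section f z $ 10 = (weight f z)^3 / z $ 2"
  by (simp_all add: normal_section_def)

lemma normal_coframe:
  "reduced_coframe f (normal_section f) 1 = (\<lambda>z v. 1 / weight f z * omega f 1 z v)"
  "reduced_coframe f (normal_section f) 3 = (\<lambda>z v. weight f z * ratio_form f 3 z v)"
  "reduced_coframe f (normal_section f) 4 = (\<lambda>z v. (weight f z)^2 * ratio_form f 4 z v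
     + (weight f z)^2 * mu43 f z * ratio_form f 3 z v)"
  "reduced_coframe f (normal_section f) 5 = (\<lambda>z v. (weight f z)^3 * ratio_form f 5 z v
     + (weight f z)^3 * mu54 f z * ratio_form f 4 z v + (weight f z)^3 * mu53 f z * ratio_form f 3 z v)"
  by (simp_all add: reduced_coframe_simps normal_section_def ratio_form_def jet_ratio_def
      fun_eq_iff diff_divide_distrib algebra_simps del: One_nat_def)

context jet_space_operator
begin

lemma mu_has_derivative:
  assumes "z \<in> J"
  shows "(mu43 f has_derivative (\<lambda>v. ((coeff_ratio f 4 2 z - (coeff_ratio f 4 1 z)^2) * omega f 1 z v
      - 7 * (ratio_form f 3 z v + (jet_ratio 4 z - (jet_ratio 3 z)^2) * omega f 1 z v)) / 4)) (at z)"
    "(mu54 f has_derivative (\<lambda>v. (ratio_form f 3 z v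
        + (jet_ratio 4 z - (jet_ratio 3 z)^2) * omega f 1 z v
      - 3 * (coeff_ratio f 4 2 z - (coeff_ratio f 4 1 z)^2) * omega f 1 z v
      + 4 * (coeff_ratio f 3 1 z - coeff_ratio f 3 0 z * coeff_ratio f 4 1 z) * omega f 1 z v) / 4)) (at z)"
    "(mu53 f has_derivative (\<lambda>v.
      ((8 * coeff_ratio f 4 1 z - 7 * coeff_ratio f 3 0 z)
        * (ratio_form f 3 z v + (jet_ratio 4 z - (jet_ratio 3 z)^2) * omega f 1 z v)
      - 11 * (ratio_form f 4 z v + (jet_ratio 5 z - jet_ratio 3 z * jet_ratio 4 z) * omega f 1 z v)
      + (8 * jet_ratio 3 z - 4 * coeff_ratio f 4 1 z + coeff_ratio f 3 0 z)
        * (coeff_ratio f 4 2 z - (coeff_ratio f 4 1 z)^2) * omega f 1 z v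
      + (coeff_ratio f 4 1 z - 7 * jet_ratio 3 z)
        * (coeff_ratio f 3 1 z - coeff_ratio f 3 0 z * coeff_ratio f 4 1 z) * omega f 1 z v
      + (coeff_ratio f 4 3 z - coeff_ratio f 4 2 z * coeff_ratio f 4 1 z) * omega f 1 z v) / 4)) (at z)"
proof -
  note D = jet_ratio_has_derivative[OF assms]
    coeff_ratio_has_derivative[OF assms, of 4 1] coeff_ratio_has_derivative[OF assms, of 4 2]
    coeff_ratio_has_derivative[OF assms, of 3 0]
  have S: "Suc 1 = 2" "Suc 2 = 3" "Suc 0 = 1" by simp_all
  note D = D[unfolded S, simplified]
  show "(mu43 f has_derivative (\<lambda>v. ((coeff_ratio f 4 2 z - (coeff_ratio f 4 1 z)^2) * omega f 1 z v
      - 7 * (ratio_form f 3 z v + (jet_ratio 4 z - (jet_ratio 3 z)^2) * omega f 1 z v)) / 4)) (at z)"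
    unfolding mu43_def[abs_def]
    by (rule derivative_eq_intros D refl | simp)+ (simp add: algebra_simps power2_eq_square)
  show "(mu54 f has_derivative (\<lambda>v. (ratio_form f 3 z v
        + (jet_ratio 4 z - (jet_ratio 3 z)^2) * omega f 1 z v
      - 3 * (coeff_ratio f 4 2 z - (coeff_ratio f 4 1 z)^2) * omega f 1 z v
      + 4 * (coeff_ratio f 3 1 z - coeff_ratio f 3 0 z * coeff_ratio f 4 1 z) * omega f 1 z v) / 4)) (at z)"
    unfolding mu54_def[abs_def]
    by (rule derivative_eq_intros D refl | simp)+ (simp add: algebra_simps power2_eq_square)
  show "(mu53 f has_derivative (\<lambda>v.
      ((8 * coeff_ratio f 4 1 z - 7 * coeff_ratio f 3 0 z)
        * (ratio_form f 3 z v + (jet_ratio 4 z - (jet_ratio 3 z)^2) * omega f 1 z v)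
      - 11 * (ratio_form f 4 z v + (jet_ratio 5 z - jet_ratio 3 z * jet_ratio 4 z) * omega f 1 z v)
      + (8 * jet_ratio 3 z - 4 * coeff_ratio f 4 1 z + coeff_ratio f 3 0 z)
        * (coeff_ratio f 4 2 z - (coeff_ratio f 4 1 z)^2) * omega f 1 z v
      + (coeff_ratio f 4 1 z - 7 * jet_ratio 3 z)
        * (coeff_ratio f 3 1 z - coeff_ratio f 3 0 z * coeff_ratio f 4 1 z) * omega f 1 z v
      + (coeff_ratio f 4 3 z - coeff_ratio f 4 2 z * coeff_ratio f 4 1 z) * omega f 1 z v) / 4)) (at z)"
    unfolding mu53_def[abs_def]
    by (rule derivative_eq_intros D refl | simp)+ (simp add: algebra_simps power2_eq_square)
qed

lemma inverse_weight_has_derivative: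
  assumes "z \<in> J" "f 4 (z $ 1) * z $ 2 > 0"
  shows "((\<lambda>y. 1 / weight f y) has_derivative (\<lambda>v. - (1 / (4 * weight f z)) *
    ((coeff_ratio f 4 1 z + jet_ratio 3 z) * omega f 1 z v + omega f 2 z v))) (at z)"
proof -
  have "weight f z \<noteq> 0" using weight_power4(1)[OF assms(2)] by simp
  then show ?thesis
    by (auto intro!: derivative_eq_intros weight_has_derivative[OF assms] simp: fun_eq_iff power2_eq_square field_simps)
qed

lemma weight_power_has_derivative:
  assumes "z \<in> J" "f 4 (z $ 1) * z $ 2 > 0"
  shows "((\<lambda>y. weight f y ^ n) has_derivative (\<lambda>v. real n / 4 * weight f z ^ n *
    ((coeff_ratio f 4 1 z + jet_ratio 3 z) * omega f 1 z v + omega f 2 z v))) (at z)"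
proof -
  have "((\<lambda>y. weight f y ^ n) has_derivative (\<lambda>v. of_nat n * (weight f z / 4 *
    ((coeff_ratio f 4 1 z + jet_ratio 3 z) * omega f 1 z v + omega f 2 z v)) * weight f z ^ (n - 1))) (at z)"
    by (rule has_derivative_power[OF weight_has_derivative[OF assms]])
  moreover have "real n * (weight f z / 4 * x) * weight f z ^ (n - 1) = real n / 4 * weight f z ^ n * x" for x
    by (cases n) simp_all
  ultimately show ?thesis by (simp only:)
qed

lemma normal_section_differentiable:
  assumes "z \<in> J" "f 4 (z $ 1) * z $ 2 > 0"
  shows "normal_section f differentiable at z"
proof (rule vec_differentiable)
  fix \<kappa> :: 10
  note w = weight_power_has_derivative[OF assms, THEN differentiableI]
  note w1 = weight_has_derivative[OF assms, THEN differentiableI]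
    inverse_weight_has_derivative[OF assms, THEN differentiableI]
  note u = vec_nth_has_derivative[THEN differentiableI]
  note D = jet_ratio_has_derivative[OF assms(1), THEN differentiableI]
    mu_has_derivative[OF assms(1), THEN differentiableI]
  show "(\<lambda>y. normal_section f y $ \<kappa>) differentiable at z"
    using exhaust_10[of \<kappa>] J_D(2)[OF assms(1)]
    by (elim disjE; simp only: normal_section_simps)
      (auto intro!: w w1 u D differentiable_divide differentiable_mult differentiable_minus differentiable_add)
qed

lemma normal_section_nonzero:
  assumes "f 4 (z $ 1) * z $ 2 > 0"
  shows "normal_section f z $ 1 > 0" "normal_section f z $ 3 \<noteq> 0" "normal_section f z $ 6 \<noteq> 0"
    "normal_section f z $ 10 \<noteq> 0"
  using weight_power4[OF assms] assms by (auto simp: normal_section_simps)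

text \<open>In the ratios, \<open>I\<^sub>1, I\<^sub>2, I\<^sub>3, I\<close> are polynomials times \<open>b, b\<^sup>3, b\<^sup>2, b\<^sup>4\<close>: the powers of \<open>f\<^sub>4\<close> and \<open>u\<close>
  in the denominators combine with the roots into a power of \<open>b\<close>.\<close>
lemma inv_ratio:
  assumes "z \<in> J" "f 4 (z $ 1) * z $ 2 > 0"
  shows "inv1 f z = - weight f z / 2 *
      (5 * jet_ratio 3 z - 3 * coeff_ratio f 4 1 z + 2 * coeff_ratio f 3 0 z)" (is "?e1")
    "inv2 f z = - ((weight f z)^3 / 64) * (20 * coeff_ratio f 3 0 z * (coeff_ratio f 4 1 z)^2
      - 16 * coeff_ratio f 3 0 z * coeff_ratio f 4 2 z - 45 * (coeff_ratio f 4 1 z)^3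
      - 16 * coeff_ratio f 4 3 z + 64 * coeff_ratio f 1 0 z
      - 16 * coeff_ratio f 2 0 z * coeff_ratio f 4 1 z
      + 60 * coeff_ratio f 4 1 z * coeff_ratio f 4 2 z
      + 35 * (jet_ratio 3 z)^3 + 240 * jet_ratio 5 z
      + (65 * (coeff_ratio f 4 1 z)^2 - 52 * coeff_ratio f 4 2 z + 112 * coeff_ratio f 2 0 z
         - 40 * coeff_ratio f 3 0 z * coeff_ratio f 4 1 z) * jet_ratio 3 z
      - 100 * jet_ratio 3 z * jet_ratio 4 z
      + (17 * coeff_ratio f 4 1 z - 28 * coeff_ratio f 3 0 z) * (jet_ratio 3 z)^2
      + (176 * coeff_ratio f 3 0 z - 84 * coeff_ratio f 4 1 z) * jet_ratio 4 z)" (is "?e2")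
    "inv3 f z = - ((weight f z)^2 / 16) * (16 * coeff_ratio f 2 0 z + 5 * (coeff_ratio f 4 1 z)^2
      - 16 * coeff_ratio f 3 1 z + 8 * coeff_ratio f 4 2 z + 5 * (jet_ratio 3 z)^2
      + 40 * jet_ratio 4 z + (32 * coeff_ratio f 3 0 z - 38 * coeff_ratio f 4 1 z) * jet_ratio 3 z)" (is "?e3")
    "inv0 f z = - ((weight f z)^4) * (jet_ratio 6 z + coeff_ratio f 3 0 z * jet_ratio 5 z
      + coeff_ratio f 2 0 z * jet_ratio 4 z + coeff_ratio f 1 0 z * jet_ratio 3 z
      + coeff_ratio f 0 0 z)" (is "?e4")
proof -
  have u: "z $ 2 \<noteq> 0" "f 4 (z $ 1) \<noteq> 0" using J_D[OF assms(1)] by auto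
  have w: "weight f z > 0" "(weight f z)^4 = f 4 (z $ 1) * z $ 2" using weight_power4[OF assms(2)] by auto
  have C: "f 3 (z $ 1) = f 4 (z $ 1) * coeff_ratio f 3 0 z" "f 2 (z $ 1) = f 4 (z $ 1) * coeff_ratio f 2 0 z"
     "f 1 (z $ 1) = f 4 (z $ 1) * coeff_ratio f 1 0 z" "f 0 (z $ 1) = f 4 (z $ 1) * coeff_ratio f 0 0 z"
     "deriv (f 4) (z $ 1) = f 4 (z $ 1) * coeff_ratio f 4 1 z"
     "deriv (f 3) (z $ 1) = f 4 (z $ 1) * coeff_ratio f 3 1 z"
     "(deriv ^^ 2) (f 4) (z $ 1) = f 4 (z $ 1) * coeff_ratio f 4 2 z"
     "(deriv ^^ 3) (f 4) (z $ 1) = f 4 (z $ 1) * coeff_ratio f 4 3 z"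
    using u by (simp_all add: coeff_ratio_def)
  have Z: "z $ 3 = z $ 2 * jet_ratio 3 z" "z $ 4 = z $ 2 * jet_ratio 4 z"
    "z $ 5 = z $ 2 * jet_ratio 5 z" "z $ 6 = z $ 2 * jet_ratio 6 z"
    using u by (simp_all add: jet_ratio_def)
  have s: "sqrt (f 4 (z $ 1) * z $ 2) = (weight f z)^2"
    using w by (intro real_sqrt_unique) (auto simp flip: power_mult)
  have r: "root 4 (f 4 (z $ 1) * z $ 2) = weight f z" by (simp add: weight_def)
  note U = Let_def C Z s r
  show "?e1" unfolding inv1_def U using u by (simp add: field_simps)
  \<comment> \<open>in the ratios, the bracket of \<open>I\<^sub>2\<close> is \<open>f\<^sub>4\<^sup>3 u\<^sup>3\<close> times a polynomial, that of \<open>I\<^sub>3\<close> is \<open>f\<^sub>4\<^sup>2 u\<^sup>2\<close> times one\<close>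
  have 2: "- (1 / (64 * m\<^sup>2 * u\<^sup>2 * b)) * (m^3 * u^3 * X) = - (b^3 / 64) * X"
    if "b^4 = m * u" "b \<noteq> 0" "m \<noteq> 0" "u \<noteq> 0" for b m u X :: real
  proof -
    have "- (1 / (64 * m\<^sup>2 * u\<^sup>2 * b)) * (m^3 * u^3 * X) = - (m * u / (64 * b) * X)"
      using that by (simp add: field_simps eval_nat_numeral)
    also have "\<dots> = - (b^3 / 64) * X" unfolding that(1)[symmetric] using that(2)
      by (simp add: field_simps eval_nat_numeral)
    finally show ?thesis .
  qed
  show "?e2" unfolding inv2_def U using u w
    by (subst 2[symmetric, where m = "f 4 (z $ 1)" and u = "z $ 2"])
      (simp_all add: algebra_simps power2_eq_square power3_eq_cube)
  have 3: "- (1 / (16 * m * b\<^sup>2 * u)) * (m\<^sup>2 * u\<^sup>2 * X) = - (b\<^sup>2 / 16) * X"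
    if "b^4 = m * u" "b \<noteq> 0" "m \<noteq> 0" "u \<noteq> 0" for b m u X :: real
  proof -
    have "- (1 / (16 * m * b\<^sup>2 * u)) * (m\<^sup>2 * u\<^sup>2 * X) = - (m * u / (16 * b\<^sup>2) * X)"
      using that by (simp add: field_simps eval_nat_numeral)
    also have "\<dots> = - (b\<^sup>2 / 16) * X" unfolding that(1)[symmetric] using that(2)
      by (simp add: field_simps eval_nat_numeral)
    finally show ?thesis .
  qed
  show "?e3" unfolding inv3_def U using u w
    by (subst 3[symmetric, where m = "f 4 (z $ 1)" and u = "z $ 2"])
      (simp_all add: algebra_simps power2_eq_square power3_eq_cube)
  show "?e4" unfolding inv0_def U w(2) by (simp add: algebra_simps)
qed

text \<open>\<open>dx\<close> is replaced by \<open>b \<theta>\<^sup>1\<close> throughout, so that no division by \<open>b\<close> is left and the claims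
  become polynomial identities. The same device serves for \<open>d\<theta>\<^sup>4\<close> and \<open>d\<theta>\<^sup>5\<close>.\<close>
lemma structure_equations_123:
  assumes "z \<in> J" "f 4 (z $ 1) * z $ 2 > 0"
  defines "\<theta> \<equiv> reduced_coframe f (normal_section f)"
  shows "ext_d (\<theta> 1) z v w = 1/4 * wedge (\<theta> 1 z) (\<theta> 2 z) v w"
    "ext_d (\<theta> 2) z v w = wedge (\<theta> 1 z) (\<theta> 3 z) v w"
    "ext_d (\<theta> 3) z v w = wedge (\<theta> 1 z) (\<theta> 4 z) v w + 1/4 * wedge (\<theta> 2 z) (\<theta> 3 z) v w"
proof -
  have w: "weight f z \<noteq> 0" using weight_power4[OF assms(2)] by simp
  have d: "(\<lambda>y. 1 / weight f y) differentiable at z" "weight f differentiable at z"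
    using inverse_weight_has_derivative[OF assms(1,2)] weight_has_derivative[OF assms(1,2)] differentiableI
    by blast+
  note \<theta> = normal_coframe[of f, folded \<theta>_def] reduced_coframe_simps(2)[of f "normal_section f", folded \<theta>_def]
  define V1 where "V1 x = omega f 1 z x / weight f z" for x
  have o: "omega f 1 z x = weight f z * V1 x" for x using w by (simp add: V1_def)
  have t1: "1 / weight f z * (weight f z * x) = x" for x using w by simp
  show "ext_d (\<theta> 1) z v w = 1/4 * wedge (\<theta> 1 z) (\<theta> 2 z) v w"
    unfolding \<theta> ext_d_mult[OF d(1) omega_differentiable[OF assms(1)]] ext_d_omega[OF assms(1)]
      wedge_def d_fun_eqI[OF inverse_weight_has_derivative[OF assms(1,2)]] o
    using w by (simp add: field_simps)
  show "ext_d (\<theta> 2) z v w = wedge (\<theta> 1 z) (\<theta> 3 z) v w"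
    unfolding \<theta> ext_d_omega2_ratio[OF assms(1)] wedge_def o using w by (simp add: field_simps)
  show "ext_d (\<theta> 3) z v w = wedge (\<theta> 1 z) (\<theta> 4 z) v w + 1/4 * wedge (\<theta> 2 z) (\<theta> 3 z) v w"
    unfolding \<theta> ext_d_mult[OF d(2) ratio_form_differentiable[OF assms(1)]]
      wedge_def d_fun_eqI[OF weight_has_derivative[OF assms(1,2)]] ext_d_ratio_form[OF assms(1,2)] o mu43_def t1
    by (simp add: algebra_simps add_divide_distrib diff_divide_distrib power2_eq_square power3_eq_cube power4_eq_xxxx)
qed

lemma structure_equation_4:
  assumes "z \<in> J" "f 4 (z $ 1) * z $ 2 > 0"
  defines "\<theta> \<equiv> reduced_coframe f (normal_section f)"
  shows "ext_d (\<theta> 4) z v w = inv1 f z * wedge (\<theta> 1 z) (\<theta> 4 z) v w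
           + wedge (\<theta> 1 z) (\<theta> 5 z) v w + 1/2 * wedge (\<theta> 2 z) (\<theta> 4 z) v w"
proof -
  have w: "weight f z \<noteq> 0" using weight_power4[OF assms(2)] by simp
  note \<theta> = normal_coframe[of f, folded \<theta>_def] reduced_coframe_simps(2)[of f "normal_section f", folded \<theta>_def]
  define V1 where "V1 x = omega f 1 z x / weight f z" for x
  have o: "omega f 1 z x = weight f z * V1 x" for x using w by (simp add: V1_def)
  have t1: "1 / weight f z * (weight f z * x) = x" for x using w by simp
  note D = weight_power_has_derivative[OF assms(1,2), of 2]
    has_derivative_mult[OF weight_power_has_derivative[OF assms(1,2), of 2] mu_has_derivative(1)[OF assms(1)]]
  note dif = D[THEN differentiableI] ratio_form_differentiable[OF assms(1)]
  have "ext_d (\<theta> 4) z v w = wedge (d_fun (\<lambda>y. (weight f y)^2) z) (ratio_form f 4 z) v w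
      + (weight f z)^2 * ext_d (ratio_form f 4) z v w
      + (wedge (d_fun (\<lambda>y. (weight f y)^2 * mu43 f y) z) (ratio_form f 3 z) v w
      + (weight f z)^2 * mu43 f z * ext_d (ratio_form f 3) z v w)"
    unfolding \<theta>
    by (subst ext_d_add, (intro differentiable_mult dif)+,
        subst ext_d_mult[OF dif(1) dif(3)], subst ext_d_mult[OF dif(2) dif(3)], rule refl)
  also have "\<dots> = inv1 f z * wedge (\<theta> 1 z) (\<theta> 4 z) v w
           + wedge (\<theta> 1 z) (\<theta> 5 z) v w + 1/2 * wedge (\<theta> 2 z) (\<theta> 4 z) v w"
    unfolding wedge_def D[THEN d_fun_eqI]
    unfolding \<theta> wedge_def ext_d_ratio_form[OF assms(1,2)] o t1
       inv_ratio(1)[OF assms(1,2)] mu43_def mu54_def mu53_def of_nat_numeral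
    by (simp add: algebra_simps add_divide_distrib diff_divide_distrib power2_eq_square power3_eq_cube power4_eq_xxxx)
  finally show ?thesis .
qed

lemma structure_equation_5:
  assumes "z \<in> J" "f 4 (z $ 1) * z $ 2 > 0"
  defines "\<theta> \<equiv> reduced_coframe f (normal_section f)"
  shows "ext_d (\<theta> 5) z v w = inv0 f z * wedge (\<theta> 1 z) (\<theta> 2 z) v w
           + inv2 f z * wedge (\<theta> 1 z) (\<theta> 3 z) v w + inv3 f z * wedge (\<theta> 1 z) (\<theta> 4 z) v w
           + wedge (\<theta> 1 z) (\<theta> 6 z) v w + 3/4 * wedge (\<theta> 2 z) (\<theta> 5 z) v w
           + 3 * wedge (\<theta> 3 z) (\<theta> 4 z) v w"
proof -
  have w: "weight f z \<noteq> 0" using weight_power4[OF assms(2)] by simp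
  note \<theta> = normal_coframe[of f, folded \<theta>_def]
    reduced_coframe_simps(2,6)[of f "normal_section f", folded \<theta>_def]
  define V1 where "V1 x = omega f 1 z x / weight f z" for x
  have o: "omega f 1 z x = weight f z * V1 x" for x using w by (simp add: V1_def)
  have t1: "1 / weight f z * (weight f z * x) = x" for x using w by simp
  note W = weight_power_has_derivative[OF assms(1,2), of 3]
  note D = W has_derivative_mult[OF W mu_has_derivative(2)[OF assms(1)]]
    has_derivative_mult[OF W mu_has_derivative(3)[OF assms(1)]]
  note dif = D[THEN differentiableI] ratio_form_differentiable[OF assms(1)]
  \<comment> \<open>the factor \<open>b\<^sup>3\<close> of \<open>\<zeta>\<^sup>5\<close> and the \<open>b\<close> in \<open>dx = b \<theta>\<^sup>1\<close> cancel the denominator \<open>b\<^sup>4\<close> of \<open>d\<zeta>\<^sup>5\<close>\<close>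
  have e5: "(weight f z)^3 * ext_d (ratio_form f 5) z v w = wedge V1 (omega f 6 z) v w
    - (weight f z)^4 * ((jet_ratio 6 z + coeff_ratio f 3 0 z * jet_ratio 5 z + coeff_ratio f 2 0 z * jet_ratio 4 z
          + coeff_ratio f 1 0 z * jet_ratio 3 z + coeff_ratio f 0 0 z)
          * wedge V1 (omega f 2 z) v w
      + (coeff_ratio f 3 0 z + jet_ratio 3 z) * wedge V1 (ratio_form f 5 z) v w
      + coeff_ratio f 2 0 z * wedge V1 (ratio_form f 4 z) v w
      + (coeff_ratio f 1 0 z + jet_ratio 5 z) * wedge V1 (ratio_form f 3 z) v w)"
  proof -
    have 1: "b^3 * (b * A / b^4 - E1 * (b * A1) - E2 * (b * A2) - E3 * (b * A3) - E4 * (b * A4))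
      = A - b^4 * (E1 * A1 + E2 * A2 + E3 * A3 + E4 * A4)" if "b \<noteq> 0"
      for b A A1 A2 A3 A4 E1 E2 E3 E4 :: real
    proof -
      have "b^3 * (b * A / b^4) = A" using that by (simp add: field_simps eval_nat_numeral)
      then show ?thesis by (simp add: algebra_simps eval_nat_numeral)
    qed
    have 2: "wedge (omega f 1 z) \<alpha> v w = weight f z * wedge V1 \<alpha> v w" for \<alpha>
      by (simp only: wedge_def o) (simp add: algebra_simps)
    show ?thesis unfolding ext_d_ratio_form(3)[OF assms(1,2)] 2 by (rule 1[OF w])
  qed
  have "ext_d (\<theta> 5) z v w = wedge (d_fun (\<lambda>y. (weight f y)^3) z) (ratio_form f 5 z) v w
      + (weight f z)^3 * ext_d (ratio_form f 5) z v w
      + (wedge (d_fun (\<lambda>y. (weight f y)^3 * mu54 f y) z) (ratio_form f 4 z) v w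
      + (weight f z)^3 * mu54 f z * ext_d (ratio_form f 4) z v w)
      + (wedge (d_fun (\<lambda>y. (weight f y)^3 * mu53 f y) z) (ratio_form f 3 z) v w
      + (weight f z)^3 * mu53 f z * ext_d (ratio_form f 3) z v w)"
    unfolding \<theta>
    by (subst ext_d_add, (intro differentiable_mult differentiable_add dif)+,
        subst ext_d_add, (intro differentiable_mult dif)+,
        subst ext_d_mult[OF dif(1) dif(4)], subst ext_d_mult[OF dif(2) dif(4)],
        subst ext_d_mult[OF dif(3) dif(4)], rule refl)
  also have "\<dots> = inv0 f z * wedge (\<theta> 1 z) (\<theta> 2 z) v w
           + inv2 f z * wedge (\<theta> 1 z) (\<theta> 3 z) v w + inv3 f z * wedge (\<theta> 1 z) (\<theta> 4 z) v w
           + wedge (\<theta> 1 z) (\<theta> 6 z) v w + 3/4 * wedge (\<theta> 2 z) (\<theta> 5 z) v w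
           + 3 * wedge (\<theta> 3 z) (\<theta> 4 z) v w"
    unfolding e5 wedge_def D[THEN d_fun_eqI]
    unfolding \<theta> wedge_def ext_d_ratio_form(1,2)[OF assms(1,2)] o t1
       inv_ratio[OF assms(1,2)] mu54_def mu53_def mu43_def of_nat_numeral
    by (simp add: algebra_simps add_divide_distrib diff_divide_distrib power2_eq_square power3_eq_cube power4_eq_xxxx)
  finally show ?thesis .
qed

end

section \<open>Essential torsion\<close>

text \<open>The form \<open>\<partial>\<theta>\<^sup>i/\<partial>a\<^sub>\<kappa>\<close> as a function of the values \<open>w\<close> of the initial coframe: the action is affine
  in the group parameters.\<close>
definition group_coeff :: "10 \<Rightarrow> nat \<Rightarrow> (nat \<Rightarrow> real) \<Rightarrow> real" where
  "group_coeff \<kappa> i w =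
    (if i = 1 then (if \<kappa> = 1 then w 1 else 0)
     else if i = 2 then 0
     else if i = 3 then (if \<kappa> = 2 then w 2 else 0) + (if \<kappa> = 3 then w 3 else 0)
     else if i = 4 then (if \<kappa> = 4 then w 2 else 0) + (if \<kappa> = 5 then w 3 else 0)
       + (if \<kappa> = 6 then w 4 else 0)
     else if i = 5 then (if \<kappa> = 7 then w 2 else 0) + (if \<kappa> = 8 then w 3 else 0)
       + (if \<kappa> = 9 then w 4 else 0) + (if \<kappa> = 10 then w 5 else 0)
     else 0)"

lemma group_act_expand:
  "group_act a w i = group_act 0 w i + (\<Sum>\<kappa>\<in>UNIV. a $ \<kappa> * group_coeff \<kappa> i w)"
  by (simp add: group_act_def group_coeff_def distrib_left sum.distrib mult_if_delta if_distrib[of "(*) _"]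
      cong: if_cong)

lemma differentiable_fst_compose:
  "g differentiable at z \<Longrightarrow> (\<lambda>P. g (fst P)) differentiable at (z, a)"
  using differentiable_chain_at[of fst "(z, a)" g]
  by (simp add: o_def differentiableI[OF has_derivative_fst[OF has_derivative_ident]])

lemma params_differentiable:
  assumes "\<sigma> differentiable at z"
  shows "(\<lambda>y. params K \<sigma> y a) differentiable at z"
proof (rule vec_differentiable)
  fix \<kappa> show "(\<lambda>y. params K \<sigma> y a $ \<kappa>) differentiable at z"
    using vec_nth_differentiable[OF assms] by (cases "\<kappa> \<in> K") (simp_all add: params_def)
qed

context jet_space_operator
begin

lemma omega_surjective:
  assumes "z \<in> J"
  shows "\<exists>v. \<forall>i\<in>{1..6}. omega f i z v = w i"
proof (intro exI ballI)
  define v :: "real^6" where "v = (\<chi> i. if i = 1 then w 1 else if i = 2 then z $ 2 * w 2 + z $ 3 * w 1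
    else if i = 3 then w 3 + z $ 4 * w 1 else if i = 4 then w 4 + z $ 5 * w 1
    else if i = 5 then w 5 + z $ 6 * w 1
    else (w 6 - (f 3 (z $ 1) * (w 5 + z $ 6 * w 1) + f 2 (z $ 1) * (w 4 + z $ 5 * w 1)
        + f 1 (z $ 1) * (w 3 + z $ 4 * w 1) + f 0 (z $ 1) * (z $ 2 * w 2 + z $ 3 * w 1)
       + (deriv (f 4) (z $ 1) * z $ 6 + deriv (f 3) (z $ 1) * z $ 5 + deriv (f 2) (z $ 1) * z $ 4
       + deriv (f 1) (z $ 1) * z $ 3 + deriv (f 0) (z $ 1) * z $ 2) * w 1)) / f 4 (z $ 1))"
  have v: "v $ 1 = w 1" "v $ 2 = z $ 2 * w 2 + z $ 3 * w 1" "v $ 3 = w 3 + z $ 4 * w 1"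
    "v $ 4 = w 4 + z $ 5 * w 1" "v $ 5 = w 5 + z $ 6 * w 1"
    "f 4 (z $ 1) * v $ 6 = w 6 - (f 3 (z $ 1) * (w 5 + z $ 6 * w 1) + f 2 (z $ 1) * (w 4 + z $ 5 * w 1)
        + f 1 (z $ 1) * (w 3 + z $ 4 * w 1) + f 0 (z $ 1) * (z $ 2 * w 2 + z $ 3 * w 1)
       + (deriv (f 4) (z $ 1) * z $ 6 + deriv (f 3) (z $ 1) * z $ 5 + deriv (f 2) (z $ 1) * z $ 4
       + deriv (f 1) (z $ 1) * z $ 3 + deriv (f 0) (z $ 1) * z $ 2) * w 1)"
    using J_D[OF assms] by (simp_all add: v_def)
  fix i :: nat assume "i \<in> {1..6}"
  then have "i = 1 \<or> i = 2 \<or> i = 3 \<or> i = 4 \<or> i = 5 \<or> i = 6" by auto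
  then show "omega f i z v = w i"
    using J_D(2)[OF assms] by (elim disjE) (simp_all add: omega_def d_jet_operator[OF assms] v)
qed

lemma omega_injective:
  assumes "z \<in> J" "\<And>i. i \<in> {1..6} \<Longrightarrow> omega f i z v = 0"
  shows "v = 0"
proof -
  have 1: "v $ 1 = 0" using assms(2)[of 1] by (simp add: omega_def)
  have 2: "v $ 2 = 0" "v $ 3 = 0" "v $ 4 = 0" "v $ 5 = 0"
    using assms(2)[of 2] assms(2)[of 3] assms(2)[of 4] assms(2)[of 5] J_D[OF assms(1)]
    by (simp_all add: omega_def 1)
  then have "v $ 6 = 0"
    using assms(2)[of 6] J_D[OF assms(1)] by (simp add: omega_def d_jet_operator[OF assms(1)] 1)
  with 1 2 have "v $ i = 0" for i using exhaust_6[of i] by auto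
  then show ?thesis by (simp add: vec_eq_iff)
qed

definition dual_basis :: "(real^6 \<Rightarrow> real^10) \<Rightarrow> real^6 \<Rightarrow> (nat \<Rightarrow> real^6) \<Rightarrow> bool" where
  "dual_basis \<tau> z E \<longleftrightarrow>
    (\<forall>i\<in>{1..6}. \<forall>j\<in>{1..6}. reduced_coframe f \<tau> i z (E j) = (if i = j then 1 else 0))"

lemma dual_basis_exists:
  assumes "z \<in> J" "\<tau> z \<in> structure_group"
  obtains E where "dual_basis \<tau> z E" and "\<And>v. v = (\<Sum>j = 1..6. reduced_coframe f \<tau> j z v *\<^sub>R E j)"
proof -
  let ?\<theta> = "\<lambda>i v. reduced_coframe f \<tau> i z v"
  have a: "\<tau> z $ 1 \<noteq> 0" "\<tau> z $ 3 \<noteq> 0" "\<tau> z $ 6 \<noteq> 0" "\<tau> z $ 10 \<noteq> 0"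
    using assms(2) by (auto simp: structure_group_def)
  have I: "i \<in> {1..6} \<longleftrightarrow> i = 1 \<or> i = 2 \<or> i = 3 \<or> i = 4 \<or> i = 5 \<or> i = 6" for i :: nat by auto
  have surj: "\<exists>v. \<forall>i\<in>{1..6}. ?\<theta> i v = t i" for t :: "nat \<Rightarrow> real"
  proof -
    define w3 where "w3 = (t 3 - \<tau> z $ 2 * t 2) / \<tau> z $ 3"
    define w4 where "w4 = (t 4 - \<tau> z $ 4 * t 2 - \<tau> z $ 5 * w3) / \<tau> z $ 6"
    define w5 where "w5 = (t 5 - \<tau> z $ 7 * t 2 - \<tau> z $ 8 * w3 - \<tau> z $ 9 * w4) / \<tau> z $ 10"
    define w where "w i = (if i = 1 then t 1 / \<tau> z $ 1 else if i = 2 then t 2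
      else if i = 3 then w3 else if i = 4 then w4 else if i = 5 then w5 else t 6)" for i :: nat
    obtain v where v: "\<forall>i\<in>{1..6}. omega f i z v = w i"
      using omega_surjective[OF assms(1), of w] ..
    have "omega f 1 z v = t 1 / \<tau> z $ 1" "omega f 2 z v = t 2" "omega f 3 z v = w3"
      "omega f 4 z v = w4" "omega f 5 z v = w5" "omega f 6 z v = t 6"
      using v by (simp_all add: w_def)
    then have "?\<theta> 1 v = t 1" "?\<theta> 2 v = t 2" "?\<theta> 3 v = t 3" "?\<theta> 4 v = t 4" "?\<theta> 5 v = t 5" "?\<theta> 6 v = t 6"
      using a by (simp_all add: reduced_coframe_simps w3_def w4_def w5_def del: One_nat_def)
    then have "?\<theta> i v = t i" if "i \<in> {1..6}" for i
      using that unfolding I by (elim disjE) simp_all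
    then show ?thesis by blast
  qed
  have inj: "v = 0" if "\<And>i. i \<in> {1..6} \<Longrightarrow> ?\<theta> i v = 0" for v
  proof (rule omega_injective[OF assms(1)])
    have 1: "omega f 1 z v = 0" "omega f 2 z v = 0" "omega f 6 z v = 0"
      using that[of 1] that[of 2] that[of 6] a by (simp_all add: reduced_coframe_simps del: One_nat_def)
    have 2: "omega f 3 z v = 0" using that[of 3] a 1 by (simp add: reduced_coframe_simps)
    have 3: "omega f 4 z v = 0" using that[of 4] a 1 2 by (simp add: reduced_coframe_simps)
    have 4: "omega f 5 z v = 0" using that[of 5] a 1 2 3 by (simp add: reduced_coframe_simps)
    show "omega f i z v = 0" if "i \<in> {1..6}" for i
      using that 1 2 3 4 unfolding I by auto
  qed
  have "\<forall>j. \<exists>v. \<forall>i\<in>{1..6}. ?\<theta> i v = (if i = j then 1 else 0)" using surj by simp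
  then obtain E where E: "\<forall>j. \<forall>i\<in>{1..6}. ?\<theta> i (E j) = (if i = j then 1 else 0)"
    unfolding choice_iff ..
  have "v - (\<Sum>j = 1..6. ?\<theta> j v *\<^sub>R E j) = 0" for v
  proof (rule inj)
    fix i :: nat assume i: "i \<in> {1..6}"
    note lin = linear_reduced_coframe[OF assms(1), of \<tau> i]
    show "?\<theta> i (v - (\<Sum>j = 1..6. ?\<theta> j v *\<^sub>R E j)) = 0"
      using E i by (simp add: linear_diff[OF lin] linear_sum[OF lin] linear_scale[OF lin] if_distrib[of "(*) _"]
          cong: if_cong)
  qed
  with E show thesis by (intro that[of E]) (simp_all add: dual_basis_def)
qed

lemma lifted_param_has_derivative:
  "((\<lambda>b. lifted f K \<sigma> i (z, b) X) has_derivative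
    (\<lambda>b. \<Sum>\<kappa>\<in>UNIV. (if \<kappa> \<in> K then b $ \<kappa> else 0) * group_coeff \<kappa> i (\<lambda>l. omega f l z (fst X)))) (at a)"
proof -
  let ?w = "\<lambda>l. omega f l z (fst X)"
  have "((\<lambda>b. params K \<sigma> z b $ \<kappa>) has_derivative (\<lambda>b. if \<kappa> \<in> K then b $ \<kappa> else 0)) (at a)" for \<kappa>
    by (cases "\<kappa> \<in> K") (simp_all add: params_def vec_nth_has_derivative)
  then have "((\<lambda>b. group_act 0 ?w i + (\<Sum>\<kappa>\<in>UNIV. params K \<sigma> z b $ \<kappa> * group_coeff \<kappa> i ?w)) has_derivative
    (\<lambda>b. 0 + (\<Sum>\<kappa>\<in>UNIV. (if \<kappa> \<in> K then b $ \<kappa> else 0) * group_coeff \<kappa> i ?w))) (at a)"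
    by (intro has_derivative_add has_derivative_sum has_derivative_mult_left has_derivative_const)
  then show ?thesis
    unfolding lifted_def fst_conv snd_conv group_act_expand[of "params K \<sigma> z _"] by simp
qed

lemma lifted_param_deriv_eq:
  "lifted_param_deriv f K \<sigma> \<kappa> i (z, a) X =
    (if \<kappa> \<in> K then group_coeff \<kappa> i (\<lambda>l. omega f l z (fst X)) else 0)"
proof -
  let ?c = "\<lambda>\<kappa>. group_coeff \<kappa> i (\<lambda>l. omega f l z (fst X))"
  have "lifted_param_deriv f K \<sigma> \<kappa> i (z, a) X
      = (\<Sum>\<kappa>'\<in>UNIV. (if \<kappa>' \<in> K then axis \<kappa> 1 $ \<kappa>' else 0) * ?c \<kappa>')"
    by (simp add: lifted_param_deriv_def
        frechet_derivative_at[OF lifted_param_has_derivative, symmetric])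
  also have "\<dots> = (\<Sum>\<kappa>'\<in>UNIV. if \<kappa>' = \<kappa> then (if \<kappa>' \<in> K then ?c \<kappa>' else 0) else 0)"
    by (rule sum.cong) (auto simp: axis_def)
  finally show ?thesis by simp
qed

text \<open>On the slice where the free parameters have the constant value \<open>a\<close>, the lifted coframe is a
  coframe along a section of the group, so the results about sections apply at every stage.\<close>
lemma lifted_eq_reduced_coframe:
  "lifted f K \<sigma> i (z, a) X = reduced_coframe f (\<lambda>y. params K \<sigma> y a) i z (fst X)"
  by (simp add: lifted_def reduced_coframe_def)

lemma lifted_differentiable:
  assumes "z \<in> J" "(\<lambda>y. params K \<sigma> y a) differentiable at z"
  shows "(\<lambda>P. lifted f K \<sigma> i P X) differentiable at (z, a)"
proof -
  have 1: "(\<lambda>P. params K \<sigma> (fst P) a $ \<kappa>) differentiable at (z, a)" for \<kappa>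
    by (rule differentiable_fst_compose[OF vec_nth_differentiable[OF assms(2)]])
  have 2: "(\<lambda>P. params K \<sigma> (fst P) (snd P) $ \<kappa>) differentiable at (z, a)" for \<kappa>
  proof (cases "\<kappa> \<in> K")
    case True
    have "((\<lambda>P. snd P $ \<kappa>) has_derivative (\<lambda>X. snd X $ \<kappa>)) (at (z, a))"
      by (intro bounded_linear_imp_has_derivative bounded_linear_compose[OF bounded_linear_vec_nth bounded_linear_snd])
    with True show ?thesis by (auto simp: params_def intro: differentiableI)
  next
    case False
    with 1[of \<kappa>] show ?thesis by (simp add: params_def)
  qed
  note D = 2 differentiable_fst_compose[OF omega_differentiable[OF assms(1)]]
  show ?thesis unfolding lifted_def group_act_def
    by (cases "i = 1"; cases "i = 2"; cases "i = 3"; cases "i = 4"; cases "i = 5")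
      (simp_all add: D differentiable_add differentiable_mult del: One_nat_def)
qed

text \<open>A tangent vector of the product is split into its components along the jet space, where the
  parameters \<open>a\<close> stay constant, and along the group, where the lifted coframe is affine.\<close>
lemma frechet_derivative_lifted:
  assumes "z \<in> J" "(\<lambda>y. params K \<sigma> y a) differentiable at z"
  shows "frechet_derivative (\<lambda>P. lifted f K \<sigma> i P Y) (at (z, a)) X =
    frechet_derivative (\<lambda>y. reduced_coframe f (\<lambda>y. params K \<sigma> y a) i y (fst Y)) (at z) (fst X)
    + (\<Sum>\<kappa>\<in>K. snd X $ \<kappa> * group_coeff \<kappa> i (\<lambda>l. omega f l z (fst Y)))"
proof -
  let ?F = "\<lambda>P. lifted f K \<sigma> i P Y" and ?c = "\<lambda>\<kappa>. group_coeff \<kappa> i (\<lambda>l. omega f l z (fst Y))"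
  define D where "D = frechet_derivative ?F (at (z, a))"
  have D: "(?F has_derivative D) (at (z, a))"
    unfolding D_def using lifted_differentiable[OF assms] by (simp flip: frechet_derivative_works)
  have "((\<lambda>y. (y, a)) has_derivative (\<lambda>v. (v, 0))) (at z)"
    by (intro derivative_eq_intros) auto
  from has_derivative_compose[OF this, of ?F D] D
  have "((\<lambda>y. reduced_coframe f (\<lambda>y. params K \<sigma> y a) i y (fst Y)) has_derivative (\<lambda>v. D (v, 0))) (at z)"
    by (simp add: lifted_eq_reduced_coframe)
  then have 1: "frechet_derivative (\<lambda>y. reduced_coframe f (\<lambda>y. params K \<sigma> y a) i y (fst Y)) (at z) v = D (v, 0)" for v
    by (simp add: frechet_derivative_at[symmetric])
  have "((\<lambda>b. (z, b)) has_derivative (\<lambda>b. (0, b))) (at a)"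
    by (intro derivative_eq_intros) auto
  from has_derivative_compose[OF this, of ?F D] D
  have 2: "((\<lambda>b. lifted f K \<sigma> i (z, b) Y) has_derivative (\<lambda>b. D (0, b))) (at a)" by simp
  have "D (0, b) = (\<Sum>\<kappa>\<in>UNIV. (if \<kappa> \<in> K then b $ \<kappa> else 0) * ?c \<kappa>)" for b
    using has_derivative_unique[OF 2 lifted_param_has_derivative] by (simp add: fun_eq_iff)
  also have "(\<Sum>\<kappa>\<in>UNIV. (if \<kappa> \<in> K then b $ \<kappa> else 0) * ?c \<kappa>) = (\<Sum>\<kappa>\<in>K. b $ \<kappa> * ?c \<kappa>)" for b
    by (simp add: sum.If_cases if_distrib[of "\<lambda>x. x * _"] cong: if_cong)
  finally have 4: "D (0, b) = (\<Sum>\<kappa>\<in>K. b $ \<kappa> * ?c \<kappa>)" for b .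
  have "D X = D ((fst X, 0) + (0, snd X))" by simp
  also have "\<dots> = D (fst X, 0) + D (0, snd X)"
    by (rule linear_add[OF has_derivative_linear[OF D]])
  finally show ?thesis by (simp add: 1 4 flip: D_def)
qed

lemma ext_d_lifted:
  assumes "z \<in> J" "(\<lambda>y. params K \<sigma> y a) differentiable at z"
  shows "ext_d (lifted f K \<sigma> i) (z, a) X Y =
    ext_d (reduced_coframe f (\<lambda>y. params K \<sigma> y a) i) z (fst X) (fst Y)
    + (\<Sum>\<kappa>\<in>K. wedge (\<lambda>X. snd X $ \<kappa>) (lifted_param_deriv f K \<sigma> \<kappa> i (z, a)) X Y)"
  unfolding ext_d_def frechet_derivative_lifted[OF assms]
  by (simp add: wedge_def lifted_param_deriv_eq sum_subtractf)

text \<open>If the forms \<open>\<partial>\<theta>\<^sup>i/\<partial>a\<^sub>\<kappa>\<close> of the free parameters vanish on \<open>E\<^sub>j\<close> and \<open>E\<^sub>k\<close>, then evaluating the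
  structure equation on these vectors leaves only \<open>T\<^sup>i\<^sub>j\<^sub>k\<close>, whatever the absorption. That torsion
  coefficients exist at all follows by absorbing nothing: after the terms with \<open>da\<^sub>\<kappa>\<close>, what is left
  is a two-form on the jet space, which expands in the coframe.\<close>
lemma essential_torsion_iff:
  assumes z: "z \<in> J" and diff: "(\<lambda>y. params K \<sigma> y a) differentiable at z"
    and sg: "params K \<sigma> z a \<in> structure_group"
    and dual: "dual_basis (\<lambda>y. params K \<sigma> y a) z E"
    and ijk: "i \<in> {1..6}" "1 \<le> j" "j < k" "k \<le> 6"
    and vanish: "\<And>\<kappa>. \<kappa> \<in> K \<Longrightarrow> group_coeff \<kappa> i (\<lambda>l. omega f l z (E j)) = 0"
      "\<And>\<kappa>. \<kappa> \<in> K \<Longrightarrow> group_coeff \<kappa> i (\<lambda>l. omega f l z (E k)) = 0"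
  shows "essential_torsion f K \<sigma> (z, a) i j k c \<longleftrightarrow>
    ext_d (reduced_coframe f (\<lambda>y. params K \<sigma> y a) i) z (E j) (E k) = c"
proof -
  let ?\<theta> = "reduced_coframe f (\<lambda>y. params K \<sigma> y a)"
  note E = dual[unfolded dual_basis_def, rule_format]
  have uniq: "T i j k = ext_d (?\<theta> i) z (E j) (E k)" if "is_torsion f K \<sigma> (z, a) T" for T
  proof -
    from that ijk(1) obtain \<pi> where
      "ext_d (lifted f K \<sigma> i) (z, a) (E j, 0) (E k, 0) =
         (\<Sum>\<kappa>\<in>K. wedge (\<pi> \<kappa>) (lifted_param_deriv f K \<sigma> \<kappa> i (z, a)) (E j, 0) (E k, 0))
         + (\<Sum>j' = 1..6. \<Sum>k' = j'+1..6.
              T i j' k' * wedge (lifted f K \<sigma> j' (z, a)) (lifted f K \<sigma> k' (z, a)) (E j, 0) (E k, 0))"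
      unfolding is_torsion_def by blast
    moreover have "(\<Sum>\<kappa>\<in>K. wedge (p \<kappa>) (lifted_param_deriv f K \<sigma> \<kappa> i (z, a)) (E j, 0) (E k, 0)) = 0" for p
      by (rule sum.neutral) (simp add: wedge_def lifted_param_deriv_eq vanish)
    ultimately have "ext_d (?\<theta> i) z (E j) (E k) = (\<Sum>j' = 1..6. \<Sum>k' = j'+1..6.
              T i j' k' * wedge (?\<theta> j' z) (?\<theta> k' z) (E j) (E k))"
      by (simp add: ext_d_lifted[OF z diff] wedge_def lifted_eq_reduced_coframe)
    also have "\<dots> = (\<Sum>j' = 1..6. \<Sum>k' = j'+1..6. if j' = j \<and> k' = k then T i j k else 0)"
      using ijk by (intro sum.cong refl) (auto simp: wedge_def E)
    also have "\<dots> = (\<Sum>j' = 1..6. if j' = j then (\<Sum>k' = j'+1..6. if k' = k then T i j k else 0) else 0)"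
      by (intro sum.cong) auto
    also have "\<dots> = T i j k" using ijk by simp
    finally show ?thesis ..
  qed
  have "\<exists>T. is_torsion f K \<sigma> (z, a) T"
  proof -
    obtain E' where E': "\<And>v. v = (\<Sum>j = 1..6. ?\<theta> j z v *\<^sub>R E' j)"
      using dual_basis_exists[where \<tau> = "\<lambda>y. params K \<sigma> y a", OF z sg] by metis
    note lin = linear_ext_d[OF open_J z linear_reduced_coframe reduced_coframe_differentiable[OF z diff]]
    have expand: "ext_d (?\<theta> i) z v w = (\<Sum>j = 1..6. \<Sum>k = j+1..6.
        ext_d (?\<theta> i) z (E' j) (E' k) * wedge (?\<theta> j z) (?\<theta> k z) v w)" for i v w
      by (rule two_form_expansion[where B = "ext_d (?\<theta> i) z", OF lin _ E']) (simp_all add: ext_d_def)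
    have "is_torsion f K \<sigma> (z, a) (\<lambda>i j k. ext_d (?\<theta> i) z (E' j) (E' k))"
      unfolding is_torsion_def
      \<comment> \<open>\<open>\<pi>\<^sup>\<kappa> = da\<^sub>\<kappa>\<close>\<close>
    proof (intro exI[where x = "\<lambda>\<kappa> X. snd X $ \<kappa>"] conjI ballI allI)
      fix \<kappa>
      show "\<exists>\<zeta>. \<forall>X. snd X $ \<kappa> = snd X $ \<kappa> + (\<Sum>j = 1..6. \<zeta> j * lifted f K \<sigma> j (z, a) X)"
        by (rule exI[where x = "\<lambda>_. 0"]) simp
    next
      fix i X Y
      have "ext_d (lifted f K \<sigma> i) (z, a) X Y
        = (\<Sum>\<kappa>\<in>K. wedge (\<lambda>X. snd X $ \<kappa>) (lifted_param_deriv f K \<sigma> \<kappa> i (z, a)) X Y)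
          + (\<Sum>j = 1..6. \<Sum>k = j+1..6. ext_d (?\<theta> i) z (E' j) (E' k)
              * wedge (?\<theta> j z) (?\<theta> k z) (fst X) (fst Y))"
        unfolding ext_d_lifted[OF z diff] by (subst expand) (rule add.commute)
      then show "ext_d (lifted f K \<sigma> i) (z, a) X Y
        = (\<Sum>\<kappa>\<in>K. wedge (\<lambda>X. snd X $ \<kappa>) (lifted_param_deriv f K \<sigma> \<kappa> i (z, a)) X Y)
          + (\<Sum>j = 1..6. \<Sum>k = j+1..6. ext_d (?\<theta> i) z (E' j) (E' k)
              * wedge (lifted f K \<sigma> j (z, a)) (lifted f K \<sigma> k (z, a)) X Y)"
        by (simp only: wedge_def[of "lifted f K \<sigma> _ (z, a)"] wedge_def[of "?\<theta> _ z"]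
            lifted_eq_reduced_coframe)
    qed
    then show ?thesis by (rule exI[of "is_torsion f K \<sigma> (z, a)"])
  qed
  with uniq show ?thesis unfolding essential_torsion_def by metis
qed

end

section \<open>The three loops of the reduction\<close>

context jet_space_operator
begin

text \<open>The coframe is triangular in \<open>\<omega>\<^sup>2, \<dots>, \<omega>\<^sup>5\<close>, so \<open>\<omega>\<^sup>i\<close> vanishes on \<open>E\<^sub>j\<close> for \<open>2 \<le> i < j\<close>, and on \<open>E\<^sub>1\<close>
  only \<open>\<omega>\<^sup>1\<close> is nonzero. These zeros are what makes the normalized coefficients essential.\<close>
lemma dual_basis_omega:
  assumes "dual_basis \<tau> z E" "\<tau> z \<in> structure_group"
  shows "omega f 1 z (E 1) = 1 / \<tau> z $ 1" "omega f 1 z (E 2) = 0" "omega f 1 z (E 3) = 0"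
    "omega f 1 z (E 4) = 0" "omega f 1 z (E 5) = 0" "omega f 1 z (E 6) = 0"
    "omega f 2 z (E 1) = 0" "omega f 2 z (E 2) = 1" "omega f 2 z (E 3) = 0"
    "omega f 2 z (E 4) = 0" "omega f 2 z (E 5) = 0" "omega f 2 z (E 6) = 0"
    "omega f 3 z (E 1) = 0" "omega f 3 z (E 2) = - \<tau> z $ 2 / \<tau> z $ 3" "omega f 3 z (E 3) = 1 / \<tau> z $ 3"
    "omega f 3 z (E 4) = 0" "omega f 3 z (E 5) = 0" "omega f 3 z (E 6) = 0"
    "omega f 4 z (E 1) = 0" "omega f 4 z (E 4) = 1 / \<tau> z $ 6" "omega f 4 z (E 5) = 0" "omega f 4 z (E 6) = 0"
    "omega f 5 z (E 1) = 0" "omega f 5 z (E 5) = 1 / \<tau> z $ 10" "omega f 5 z (E 6) = 0"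
    "omega f 6 z (E 1) = 0" "omega f 6 z (E 5) = 0" "omega f 6 z (E 6) = 1"
proof -
  have a: "\<tau> z $ 1 \<noteq> 0" "\<tau> z $ 3 \<noteq> 0" "\<tau> z $ 6 \<noteq> 0" "\<tau> z $ 10 \<noteq> 0"
    using assms(2) by (auto simp: structure_group_def)
  have E: "reduced_coframe f \<tau> i z (E j) = (if i = j then 1 else 0)" if "i \<in> {1..6}" "j \<in> {1..6}" for i j
    using assms(1) that unfolding dual_basis_def by blast
  note R = reduced_coframe_simps
  have e: "\<tau> z $ 1 * omega f 1 z (E j) = (if j = 1 then 1 else 0)" "omega f 2 z (E j) = (if j = 2 then 1 else 0)"
    "\<tau> z $ 2 * omega f 2 z (E j) + \<tau> z $ 3 * omega f 3 z (E j) = (if j = 3 then 1 else 0)"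
    "\<tau> z $ 4 * omega f 2 z (E j) + \<tau> z $ 5 * omega f 3 z (E j) + \<tau> z $ 6 * omega f 4 z (E j)
      = (if j = 4 then 1 else 0)"
    "\<tau> z $ 7 * omega f 2 z (E j) + \<tau> z $ 8 * omega f 3 z (E j) + \<tau> z $ 9 * omega f 4 z (E j)
      + \<tau> z $ 10 * omega f 5 z (E j) = (if j = 5 then 1 else 0)"
    "omega f 6 z (E j) = (if j = 6 then 1 else 0)" if "j \<in> {1..6}" for j
    using E[of 1 j] E[of 2 j] E[of 3 j] E[of 4 j] E[of 5 j] E[of 6 j] that
    by (simp_all add: R del: One_nat_def split: if_splits)
  show 1: "omega f 1 z (E 1) = 1 / \<tau> z $ 1" "omega f 1 z (E 2) = 0" "omega f 1 z (E 3) = 0"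
    "omega f 1 z (E 4) = 0" "omega f 1 z (E 5) = 0" "omega f 1 z (E 6) = 0"
    using e(1)[of 1] e(1)[of 2] e(1)[of 3] e(1)[of 4] e(1)[of 5] e(1)[of 6] a
    by (simp_all add: field_simps del: One_nat_def)
  show 2: "omega f 2 z (E 1) = 0" "omega f 2 z (E 2) = 1" "omega f 2 z (E 3) = 0"
    "omega f 2 z (E 4) = 0" "omega f 2 z (E 5) = 0" "omega f 2 z (E 6) = 0"
    by (simp_all add: e(2) del: One_nat_def)
  show 3: "omega f 3 z (E 1) = 0" "omega f 3 z (E 3) = 1 / \<tau> z $ 3"
    "omega f 3 z (E 4) = 0" "omega f 3 z (E 5) = 0" "omega f 3 z (E 6) = 0"
    using e(3)[of 1] e(3)[of 3] e(3)[of 4] e(3)[of 5] e(3)[of 6] a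
    by (simp_all add: 2 field_simps del: One_nat_def)
  show "omega f 3 z (E 2) = - \<tau> z $ 2 / \<tau> z $ 3"
    using e(3)[of 2] a by (simp add: 2 field_simps del: One_nat_def)
  show 4: "omega f 4 z (E 1) = 0" "omega f 4 z (E 4) = 1 / \<tau> z $ 6" "omega f 4 z (E 5) = 0" "omega f 4 z (E 6) = 0"
    using e(4)[of 1] e(4)[of 4] e(4)[of 5] e(4)[of 6] a
    by (simp_all add: 2 3 field_simps del: One_nat_def)
  show "omega f 5 z (E 1) = 0" "omega f 5 z (E 5) = 1 / \<tau> z $ 10" "omega f 5 z (E 6) = 0"
    using e(5)[of 1] e(5)[of 5] e(5)[of 6] a
    by (simp_all add: 2 3 4 field_simps del: One_nat_def)
  show "omega f 6 z (E 1) = 0" "omega f 6 z (E 5) = 0" "omega f 6 z (E 6) = 1"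
    by (simp_all add: e(6) del: One_nat_def)
qed

text \<open>For \<open>i = 3, 4, 5\<close> the forms \<open>\<omega>\<^sup>2, \<dots>, \<omega>\<^sup>i\<close> vanish on both \<open>E\<^sub>1\<close> and \<open>E\<^sub>i\<^sub>+\<^sub>1\<close>; so the derivatives of
  the parameters drop out of \<open>T\<^sup>i\<^sub>1\<^sub>,\<^sub>i\<^sub>+\<^sub>1\<close>, and only the last of the \<open>d\<omega>\<^sup>l\<close> contributes.\<close>
lemma first_loop_torsion:
  assumes "z \<in> J" "\<tau> differentiable at z" "\<tau> z \<in> structure_group" "dual_basis \<tau> z E"
  shows "ext_d (reduced_coframe f \<tau> 2) z (E 1) (E 2)
      = - (\<tau> z $ 2 + \<tau> z $ 3 * z $ 3) / (\<tau> z $ 1 * \<tau> z $ 3 * z $ 2)"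
    "ext_d (reduced_coframe f \<tau> 2) z (E 1) (E 3) = 1 / (\<tau> z $ 1 * \<tau> z $ 3 * z $ 2)"
    "ext_d (reduced_coframe f \<tau> 3) z (E 1) (E 4) = \<tau> z $ 3 / (\<tau> z $ 1 * \<tau> z $ 6)"
    "ext_d (reduced_coframe f \<tau> 4) z (E 1) (E 5) = \<tau> z $ 6 / (\<tau> z $ 1 * \<tau> z $ 10)"
    "ext_d (reduced_coframe f \<tau> 5) z (E 1) (E 6) = \<tau> z $ 10 / (\<tau> z $ 1 * f 4 (z $ 1))"
proof -
  have a: "\<tau> z $ 1 \<noteq> 0" "\<tau> z $ 3 \<noteq> 0" "\<tau> z $ 6 \<noteq> 0" "\<tau> z $ 10 \<noteq> 0"
    using assms(3) by (auto simp: structure_group_def)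
  note S = ext_d_reduced_coframe[OF assms(1,2)] reduced_coframe_simps(2) ext_d_omega[OF assms(1)] wedge_def
    dual_basis_omega[OF assms(4,3)]
  show "ext_d (reduced_coframe f \<tau> 2) z (E 1) (E 2)
      = - (\<tau> z $ 2 + \<tau> z $ 3 * z $ 3) / (\<tau> z $ 1 * \<tau> z $ 3 * z $ 2)"
    unfolding S using a J_D[OF assms(1)] by (simp add: field_simps)
  show "ext_d (reduced_coframe f \<tau> 2) z (E 1) (E 3) = 1 / (\<tau> z $ 1 * \<tau> z $ 3 * z $ 2)"
    "ext_d (reduced_coframe f \<tau> 3) z (E 1) (E 4) = \<tau> z $ 3 / (\<tau> z $ 1 * \<tau> z $ 6)"
    "ext_d (reduced_coframe f \<tau> 4) z (E 1) (E 5) = \<tau> z $ 6 / (\<tau> z $ 1 * \<tau> z $ 10)"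
    "ext_d (reduced_coframe f \<tau> 5) z (E 1) (E 6) = \<tau> z $ 10 / (\<tau> z $ 1 * f 4 (z $ 1))"
    unfolding S by simp_all
qed

lemma first_loop_iff:
  assumes "z \<in> J" "a \<in> structure_group"
  shows "(\<forall>(i, j, k, c)\<in>{(2, 1, 2, 0), (2, 1, 3, 1), (3, 1, 4, 1), (4, 1, 5, 1), (5, 1, 6, 1)}.
      essential_torsion f UNIV \<sigma> (z, a) i j k c) \<longleftrightarrow>
    a $ 2 = - a $ 3 * z $ 3 \<and> a $ 1 * a $ 3 * z $ 2 = 1 \<and> a $ 3 = a $ 1 * a $ 6
      \<and> a $ 6 = a $ 1 * a $ 10 \<and> a $ 10 = a $ 1 * f 4 (z $ 1)"
proof -
  let ?\<tau> = "\<lambda>y. params UNIV \<sigma> y a"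
  have \<tau>: "params UNIV \<sigma> y a = a" for y by (simp add: params_def)
  have diff: "?\<tau> differentiable at z" by (simp add: \<tau>)
  have sg: "?\<tau> z \<in> structure_group" using assms(2) by (simp add: \<tau>)
  obtain E where E: "dual_basis ?\<tau> z E" using dual_basis_exists[of z ?\<tau>, OF assms(1) sg] .
  note O = dual_basis_omega[OF E sg]
  note I = essential_torsion_iff[OF assms(1) diff sg E]
  have "essential_torsion f UNIV \<sigma> (z, a) 2 1 2 c \<longleftrightarrow> ext_d (reduced_coframe f ?\<tau> 2) z (E 1) (E 2) = c"
    "essential_torsion f UNIV \<sigma> (z, a) 2 1 3 c \<longleftrightarrow> ext_d (reduced_coframe f ?\<tau> 2) z (E 1) (E 3) = c"
    "essential_torsion f UNIV \<sigma> (z, a) 3 1 4 c \<longleftrightarrow> ext_d (reduced_coframe f ?\<tau> 3) z (E 1) (E 4) = c"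
    "essential_torsion f UNIV \<sigma> (z, a) 4 1 5 c \<longleftrightarrow> ext_d (reduced_coframe f ?\<tau> 4) z (E 1) (E 5) = c"
    "essential_torsion f UNIV \<sigma> (z, a) 5 1 6 c \<longleftrightarrow> ext_d (reduced_coframe f ?\<tau> 5) z (E 1) (E 6) = c" for c
    by (rule I; simp add: group_coeff_def O del: One_nat_def)+
  note T = this[unfolded first_loop_torsion[OF assms(1) diff sg E], unfolded \<tau>]
  have a: "a $ 1 \<noteq> 0" "a $ 3 \<noteq> 0" "a $ 6 \<noteq> 0" "a $ 10 \<noteq> 0"
    using assms(2) by (auto simp: structure_group_def)
  show ?thesis
    using a J_D[OF assms(1)] by (auto simp: T field_simps add_eq_0_iff simp del: One_nat_def)
qed

text \<open>Substituting each of the last four equations into the one before it gives \<open>a\<^sub>1\<^sup>4 f\<^sub>4 u = 1\<close>; hence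
  \<open>f\<^sub>4 u > 0\<close>, and the sign of \<open>a\<^sub>1\<close> selects \<open>a\<^sub>1 = 1/b\<close>.\<close>
lemma first_loop_solution:
  assumes "z \<in> J" "a $ 1 > 0"
  shows "(a $ 2 = - a $ 3 * z $ 3 \<and> a $ 1 * a $ 3 * z $ 2 = 1 \<and> a $ 3 = a $ 1 * a $ 6
      \<and> a $ 6 = a $ 1 * a $ 10 \<and> a $ 10 = a $ 1 * f 4 (z $ 1)) \<longleftrightarrow>
    f 4 (z $ 1) * z $ 2 > 0 \<and> (\<forall>\<kappa>\<in>{1, 2, 3, 6, 10}. a $ \<kappa> = normal_section f z $ \<kappa>)"
proof
  assume *: "a $ 2 = - a $ 3 * z $ 3 \<and> a $ 1 * a $ 3 * z $ 2 = 1 \<and> a $ 3 = a $ 1 * a $ 6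
      \<and> a $ 6 = a $ 1 * a $ 10 \<and> a $ 10 = a $ 1 * f 4 (z $ 1)"
  have u: "z $ 2 \<noteq> 0" using J_D[OF assms(1)] by simp
  have "(a $ 1)^4 * (f 4 (z $ 1) * z $ 2) = 1"
  proof -
    have "a $ 3 = a $ 1 * (a $ 1 * (a $ 1 * f 4 (z $ 1)))" using * by metis
    moreover have "a $ 1 * a $ 3 * z $ 2 = 1" using * by blast
    ultimately show ?thesis by (simp add: power4_eq_xxxx mult_ac)
  qed
  then have m: "f 4 (z $ 1) * z $ 2 = (1 / a $ 1)^4"
    using assms(2) by (simp add: power_divide field_simps)
  then have w: "weight f z = 1 / a $ 1"
    unfolding weight_def using assms(2) by (simp add: real_root_power_cancel)
  have a1: "a $ 1 = 1 / weight f z" "weight f z > 0" using w assms(2) by simp_all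
  have a3: "a $ 3 = weight f z / z $ 2"
    using * u a1 by (auto simp: field_simps)
  have "a $ 6 = a $ 3 / a $ 1" "a $ 10 = a $ 6 / a $ 1" using * assms(2) by simp_all
  then have a6: "a $ 6 = (weight f z)^2 / z $ 2" and a10: "a $ 10 = (weight f z)^3 / z $ 2"
    unfolding a3 a1(1) by (simp_all add: power2_eq_square power3_eq_cube)
  have a2: "a $ 2 = - weight f z * jet_ratio 3 z"
    using * a3 by (simp add: jet_ratio_def)
  have "f 4 (z $ 1) * z $ 2 > 0" using m assms(2) by simp
  then show "f 4 (z $ 1) * z $ 2 > 0 \<and> (\<forall>\<kappa>\<in>{1, 2, 3, 6, 10}. a $ \<kappa> = normal_section f z $ \<kappa>)"
    using a1 a2 a3 a6 a10 by (auto simp: normal_section_simps)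
next
  assume *: "f 4 (z $ 1) * z $ 2 > 0 \<and> (\<forall>\<kappa>\<in>{1, 2, 3, 6, 10}. a $ \<kappa> = normal_section f z $ \<kappa>)"
  note w = weight_power4[OF conjunct1[OF *]]
  have u: "z $ 2 \<noteq> 0" using J_D[OF assms(1)] by simp
  have "f 4 (z $ 1) = (weight f z)^4 / z $ 2" using w u by simp
  then show "a $ 2 = - a $ 3 * z $ 3 \<and> a $ 1 * a $ 3 * z $ 2 = 1 \<and> a $ 3 = a $ 1 * a $ 6
      \<and> a $ 6 = a $ 1 * a $ 10 \<and> a $ 10 = a $ 1 * f 4 (z $ 1)"
    using * w(1) u by (simp add: normal_section_simps jet_ratio_def eval_nat_numeral)
qed

text \<open>After the first loop, \<open>\<theta>\<^sup>1, \<theta>\<^sup>2, \<theta>\<^sup>3\<close> are those of the normal section near \<open>z\<close>. Its equation for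
  \<open>d\<theta>\<^sup>3\<close> says that \<open>T\<^sup>3\<^sub>1\<^sub>k\<close> is the normal \<open>\<theta>\<^sup>4\<close> on \<open>E\<^sub>k\<close>. Since the present \<open>\<theta>\<^sup>4\<close> vanishes there for
  \<open>k = 2, 3\<close>, this measures how far \<open>a\<^sub>4, a\<^sub>5\<close> are from their normal values. For \<open>T\<^sup>5\<^sub>1\<^sub>5\<close> the only
  derivative of a parameter that enters is that of \<open>a\<^sub>1\<^sub>0\<close>, known from the first loop.\<close>
lemma second_loop_iff:
  assumes \<Gamma>: "open \<Gamma>" "\<Gamma> \<subseteq> J" "z \<in> \<Gamma>" and pos: "\<And>y. y \<in> \<Gamma> \<Longrightarrow> f 4 (y $ 1) * y $ 2 > 0"
    and \<sigma>: "\<sigma> differentiable at z"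
    and agree: "\<And>y \<kappa>. y \<in> \<Gamma> \<Longrightarrow> \<kappa> \<in> {1, 2, 3, 6, 10} \<Longrightarrow> \<sigma> y $ \<kappa> = normal_section f y $ \<kappa>"
  shows "(\<forall>(i, j, k, c)\<in>{(3, 1, 2, 0), (3, 1, 3, 0), (5, 1, 5, 0)}.
      essential_torsion f {4, 5, 7, 8, 9} \<sigma> (z, a) i j k c) \<longleftrightarrow>
    (\<forall>\<kappa>\<in>{4, 5, 9}. a $ \<kappa> = normal_section f z $ \<kappa>)"
proof -
  let ?K = "{4, 5, 7, 8, 9} :: 10 set" and ?\<theta> = "reduced_coframe f (normal_section f)"
  define \<tau> where "\<tau> y = params ?K \<sigma> y a" for y
  have z: "z \<in> J" using \<Gamma> by blast
  note p = pos[OF \<Gamma>(3)]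
  have \<tau>: "\<tau> y $ 1 = normal_section f y $ 1" "\<tau> y $ 2 = normal_section f y $ 2"
    "\<tau> y $ 3 = normal_section f y $ 3" "\<tau> y $ 6 = normal_section f y $ 6"
    "\<tau> y $ 10 = normal_section f y $ 10" if "y \<in> \<Gamma>" for y
    using agree[OF that] by (simp_all add: \<tau>_def params_def)
  have \<tau>a: "\<tau> y $ 4 = a $ 4" "\<tau> y $ 5 = a $ 5" "\<tau> y $ 9 = a $ 9" for y
    by (simp_all add: \<tau>_def params_def)
  have diff: "\<tau> differentiable at z"
    unfolding \<tau>_def using params_differentiable[OF \<sigma>] .
  have sg: "\<tau> z \<in> structure_group"
    using normal_section_nonzero[OF p] by (simp add: structure_group_def \<tau>[OF \<Gamma>(3)])
  obtain E where E: "dual_basis \<tau> z E" using dual_basis_exists[of z \<tau>, OF z sg] .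
  note O = dual_basis_omega[OF E sg]
  have T: "essential_torsion f ?K \<sigma> (z, a) 3 1 2 c \<longleftrightarrow> ext_d (reduced_coframe f \<tau> 3) z (E 1) (E 2) = c"
    "essential_torsion f ?K \<sigma> (z, a) 3 1 3 c \<longleftrightarrow> ext_d (reduced_coframe f \<tau> 3) z (E 1) (E 3) = c"
    "essential_torsion f ?K \<sigma> (z, a) 5 1 5 c \<longleftrightarrow> ext_d (reduced_coframe f \<tau> 5) z (E 1) (E 5) = c" for c
    unfolding \<tau>_def
    by (rule essential_torsion_iff[OF z diff[unfolded \<tau>_def] sg[unfolded \<tau>_def] E[unfolded \<tau>_def]];
        auto simp: group_coeff_def O simp del: One_nat_def)+
  have e: "reduced_coframe f \<tau> 3 y v = ?\<theta> 3 y v" if "y \<in> \<Gamma>" for y v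
    by (simp add: reduced_coframe_simps \<tau>[OF that])
  have e1: "?\<theta> 1 z = reduced_coframe f \<tau> 1 z" "?\<theta> 2 z = reduced_coframe f \<tau> 2 z" "?\<theta> 3 z = reduced_coframe f \<tau> 3 z"
    by (simp_all add: reduced_coframe_simps \<tau>[OF \<Gamma>(3)] del: One_nat_def)
  \<comment> \<open>the two coframes differ in \<open>\<theta>\<^sup>4\<close> only by the parameters that are still free\<close>
  have e4: "?\<theta> 4 z v = reduced_coframe f \<tau> 4 z v + (normal_section f z $ 4 - a $ 4) * omega f 2 z v
    + (normal_section f z $ 5 - a $ 5) * omega f 3 z v" for v
    by (simp add: reduced_coframe_simps \<tau>[OF \<Gamma>(3)] \<tau>a algebra_simps)
  have T3: "ext_d (reduced_coframe f \<tau> 3) z (E 1) (E k) = (normal_section f z $ 4 - a $ 4) * omega f 2 z (E k)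
    + (normal_section f z $ 5 - a $ 5) * omega f 3 z (E k)" if "k \<in> {2, 3}" for k
  proof -
    have "ext_d (reduced_coframe f \<tau> 3) z (E 1) (E k) = ext_d (?\<theta> 3) z (E 1) (E k)"
      by (rule ext_d_cong[OF \<Gamma>(1,3) e])
    also have "\<dots> = wedge (?\<theta> 1 z) (?\<theta> 4 z) (E 1) (E k) + 1/4 * wedge (?\<theta> 2 z) (?\<theta> 3 z) (E 1) (E k)"
      by (rule structure_equations_123(3)[OF z p])
    also have "\<dots> = (normal_section f z $ 4 - a $ 4) * omega f 2 z (E k)
      + (normal_section f z $ 5 - a $ 5) * omega f 3 z (E k)"
      using that E unfolding wedge_def e1 e4 dual_basis_def by auto
    finally show ?thesis .
  qed
  have b: "normal_section f z $ 1 \<noteq> 0" "normal_section f z $ 10 \<noteq> 0" "normal_section f z $ 3 \<noteq> 0"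
    using normal_section_nonzero[OF p] by auto
  have w: "weight f z \<noteq> 0" "z $ 2 \<noteq> 0" "f 4 (z $ 1) \<noteq> 0" using weight_power4[OF p] J_D[OF z] by auto
  have T5: "ext_d (reduced_coframe f \<tau> 5) z (E 1) (E 5) = (a $ 9 - normal_section f z $ 9)
      / (normal_section f z $ 1 * normal_section f z $ 10)"
  proof -
    have "d_fun (\<lambda>y. \<tau> y $ 10) z (E 1) = d_fun (\<lambda>y. (weight f y)^3 * (1 / y $ 2)) z (E 1)"
      by (rule d_fun_cong[OF \<Gamma>(1,3)]) (simp add: \<tau> normal_section_simps)
    also have "\<dots> = (weight f z)^3 / z $ 2 * (3/4 * (coeff_ratio f 4 1 z + jet_ratio 3 z) - jet_ratio 3 z)
        * omega f 1 z (E 1)"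
      by (subst d_fun_eqI[OF has_derivative_mult[OF weight_power_has_derivative[OF z p] inverse_u_has_derivative[OF z]]])
        (simp add: O algebra_simps diff_divide_distrib add_divide_distrib del: One_nat_def)
    finally have d: "d_fun (\<lambda>y. \<tau> y $ 10) z (E 1) = normal_section f z $ 10
        * (3/4 * (coeff_ratio f 4 1 z + jet_ratio 3 z) - jet_ratio 3 z) / normal_section f z $ 1"
      by (simp add: O \<tau>[OF \<Gamma>(3)] normal_section_simps del: One_nat_def)
    have n9: "normal_section f z $ 9 = normal_section f z $ 10 * mu54 f z" by (simp add: normal_section_simps)
    have k: "f 3 (z $ 1) = f 4 (z $ 1) * coeff_ratio f 3 0 z" using w by (simp add: coeff_ratio_def)
    show ?thesis
      unfolding ext_d_reduced_coframe[OF z diff] ext_d_omega[OF z] wedge_def O d n9 mu54_def k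
      using w b by (simp add: \<tau>[OF \<Gamma>(3)] \<tau>a field_simps)
  qed
  show ?thesis
    using b by (auto simp: T T3 T5 O \<tau>[OF \<Gamma>(3)] simp del: One_nat_def)
qed

text \<open>The argument for \<open>a\<^sub>4, a\<^sub>5\<close> one step higher: \<open>\<theta>\<^sup>1, \<dots>, \<theta>\<^sup>4\<close> are now normal, and by the equation for
  \<open>d\<theta>\<^sup>4\<close> the coefficient \<open>T\<^sup>4\<^sub>1\<^sub>k\<close> is the normal \<open>\<theta>\<^sup>5\<close> on \<open>E\<^sub>k\<close>.\<close>
lemma third_loop_iff:
  assumes \<Gamma>: "open \<Gamma>" "\<Gamma> \<subseteq> J" "z \<in> \<Gamma>" and pos: "\<And>y. y \<in> \<Gamma> \<Longrightarrow> f 4 (y $ 1) * y $ 2 > 0"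
    and \<sigma>: "\<sigma> differentiable at z"
    and agree: "\<And>y \<kappa>. y \<in> \<Gamma> \<Longrightarrow> \<kappa> \<notin> {7, 8} \<Longrightarrow> \<sigma> y $ \<kappa> = normal_section f y $ \<kappa>"
  shows "(\<forall>(i, j, k, c)\<in>{(4, 1, 2, 0), (4, 1, 3, 0)}.
      essential_torsion f {7, 8} \<sigma> (z, a) i j k c) \<longleftrightarrow>
    (\<forall>\<kappa>\<in>{7, 8}. a $ \<kappa> = normal_section f z $ \<kappa>)"
proof -
  let ?K = "{7, 8} :: 10 set" and ?\<theta> = "reduced_coframe f (normal_section f)"
  define \<tau> where "\<tau> y = params ?K \<sigma> y a" for y
  have z: "z \<in> J" using \<Gamma> by blast
  note p = pos[OF \<Gamma>(3)]
  have \<tau>: "\<tau> y $ \<kappa> = normal_section f y $ \<kappa>" if "y \<in> \<Gamma>" "\<kappa> \<notin> {7, 8}" for y \<kappa>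
    using agree[OF that] that(2) by (simp add: \<tau>_def params_def)
  have \<tau>a: "\<tau> y $ 7 = a $ 7" "\<tau> y $ 8 = a $ 8" for y
    by (simp_all add: \<tau>_def params_def)
  have diff: "\<tau> differentiable at z"
    unfolding \<tau>_def using params_differentiable[OF \<sigma>] .
  have sg: "\<tau> z \<in> structure_group"
    using normal_section_nonzero[OF p] by (simp add: structure_group_def \<tau>[OF \<Gamma>(3)])
  obtain E where E: "dual_basis \<tau> z E" using dual_basis_exists[of z \<tau>, OF z sg] .
  note O = dual_basis_omega[OF E sg]
  have T: "essential_torsion f ?K \<sigma> (z, a) 4 1 2 c \<longleftrightarrow> ext_d (reduced_coframe f \<tau> 4) z (E 1) (E 2) = c"
    "essential_torsion f ?K \<sigma> (z, a) 4 1 3 c \<longleftrightarrow> ext_d (reduced_coframe f \<tau> 4) z (E 1) (E 3) = c" for c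
    unfolding \<tau>_def
    by (rule essential_torsion_iff[OF z diff[unfolded \<tau>_def] sg[unfolded \<tau>_def] E[unfolded \<tau>_def]];
        auto simp: group_coeff_def)+
  have e: "reduced_coframe f \<tau> 4 y v = ?\<theta> 4 y v" if "y \<in> \<Gamma>" for y v
    by (simp add: reduced_coframe_simps \<tau>[OF that])
  have e1: "?\<theta> 1 z = reduced_coframe f \<tau> 1 z" "?\<theta> 2 z = reduced_coframe f \<tau> 2 z" "?\<theta> 4 z = reduced_coframe f \<tau> 4 z"
    by (simp_all add: reduced_coframe_simps \<tau>[OF \<Gamma>(3)] del: One_nat_def)
  \<comment> \<open>\<open>a\<^sub>9\<close> and \<open>a\<^sub>1\<^sub>0\<close> are already normal, so only \<open>a\<^sub>7\<close> and \<open>a\<^sub>8\<close> distinguish the two forms \<open>\<theta>\<^sup>5\<close>\<close>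
  have e5: "?\<theta> 5 z v = reduced_coframe f \<tau> 5 z v + (normal_section f z $ 7 - a $ 7) * omega f 2 z v
    + (normal_section f z $ 8 - a $ 8) * omega f 3 z v" for v
    by (simp add: reduced_coframe_simps \<tau>[OF \<Gamma>(3)] \<tau>a algebra_simps)
  have T4: "ext_d (reduced_coframe f \<tau> 4) z (E 1) (E k) = (normal_section f z $ 7 - a $ 7) * omega f 2 z (E k)
    + (normal_section f z $ 8 - a $ 8) * omega f 3 z (E k)" if "k \<in> {2, 3}" for k
  proof -
    have "ext_d (reduced_coframe f \<tau> 4) z (E 1) (E k) = ext_d (?\<theta> 4) z (E 1) (E k)"
      by (rule ext_d_cong[OF \<Gamma>(1,3) e])
    also have "\<dots> = inv1 f z * wedge (?\<theta> 1 z) (?\<theta> 4 z) (E 1) (E k) + wedge (?\<theta> 1 z) (?\<theta> 5 z) (E 1) (E k)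
        + 1/2 * wedge (?\<theta> 2 z) (?\<theta> 4 z) (E 1) (E k)"
      by (rule structure_equation_4[OF z p])
    also have "\<dots> = (normal_section f z $ 7 - a $ 7) * omega f 2 z (E k)
      + (normal_section f z $ 8 - a $ 8) * omega f 3 z (E k)"
      using that E unfolding wedge_def e1 e5 dual_basis_def by auto
    finally show ?thesis .
  qed
  have b: "normal_section f z $ 3 \<noteq> 0"
    using normal_section_nonzero[OF p] by auto
  show ?thesis
    using b by (auto simp: T T4 O \<tau>[OF \<Gamma>(3)] simp del: One_nat_def)
qed

text \<open>A normalization constrains every group element that agrees with \<open>\<sigma>\<close> in the parameters just
  normalized. Taking \<open>\<sigma> z\<close> itself, at each point of \<open>\<Gamma>\<close>, determines \<open>\<sigma>\<close> loop by loop; the later loops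
  use the outcome of the earlier ones on the whole open set \<open>\<Gamma>\<close>, since they differentiate it.\<close>
lemma cartan_normalization_iff:
  assumes \<Gamma>: "open \<Gamma>" "\<Gamma> \<subseteq> J" and pos: "\<And>z. z \<in> \<Gamma> \<Longrightarrow> \<sigma> z $ 1 > 0"
  shows "cartan_normalization f \<Gamma> \<sigma> \<longleftrightarrow>
    (\<forall>z\<in>\<Gamma>. f 4 (z $ 1) * z $ 2 > 0 \<and> \<sigma> z = normal_section f z)"
proof -
  have K: "(UNIV :: 10 set) - {4, 5, 7, 8, 9} = {1, 2, 3, 6, 10}" "{4, 5, 7, 8, 9} - {7, 8 :: 10} = {4, 5, 9}"
    "{7, 8 :: 10} - {} = {7, 8}"
  proof -
    show "(UNIV :: 10 set) - {4, 5, 7, 8, 9} = {1, 2, 3, 6, 10}"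
    proof (rule set_eqI)
      fix \<kappa> :: 10 show "\<kappa> \<in> UNIV - {4, 5, 7, 8, 9} \<longleftrightarrow> \<kappa> \<in> {1, 2, 3, 6, 10}"
        using exhaust_10[of \<kappa>] by (elim disjE) simp_all
    qed
  qed auto
  have J: "z \<in> J" if "z \<in> \<Gamma>" for z using \<Gamma>(2) that by blast
  show ?thesis
  proof
    assume C: "cartan_normalization f \<Gamma> \<sigma>"
    then have \<sigma>: "\<And>z. z \<in> \<Gamma> \<Longrightarrow> \<sigma> z \<in> structure_group" "\<And>z. z \<in> \<Gamma> \<Longrightarrow> \<sigma> differentiable at z"
      and steps: "normalization_step f \<Gamma> \<sigma> UNIV {4, 5, 7, 8, 9}
        {(2, 1, 2, 0), (2, 1, 3, 1), (3, 1, 4, 1), (4, 1, 5, 1), (5, 1, 6, 1)}"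
        "normalization_step f \<Gamma> \<sigma> {4, 5, 7, 8, 9} {7, 8} {(3, 1, 2, 0), (3, 1, 3, 0), (5, 1, 5, 0)}"
        "normalization_step f \<Gamma> \<sigma> {7, 8} {} {(4, 1, 2, 0), (4, 1, 3, 0)}"
      unfolding cartan_normalization_def by blast+
    have *: "\<forall>(i, j, k, c)\<in>N. essential_torsion f K \<sigma> (z, \<sigma> z) i j k c"
      if "normalization_step f \<Gamma> \<sigma> K K' N" "z \<in> \<Gamma>" for K K' N z
      using that \<sigma>(1)[OF that(2)] unfolding normalization_step_def by simp
    have 1: "f 4 (z $ 1) * z $ 2 > 0 \<and> (\<forall>\<kappa>\<in>{1, 2, 3, 6, 10}. \<sigma> z $ \<kappa> = normal_section f z $ \<kappa>)"
      if "z \<in> \<Gamma>" for z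
      using *[OF steps(1) that] first_loop_iff[OF J[OF that] \<sigma>(1)[OF that]]
        first_loop_solution[OF J[OF that] pos[OF that]] by blast
    have 2: "\<forall>\<kappa>\<in>{4, 5, 9}. \<sigma> z $ \<kappa> = normal_section f z $ \<kappa>" if "z \<in> \<Gamma>" for z
      using *[OF steps(2) that]
      by (subst (asm) second_loop_iff[OF \<Gamma> that _ \<sigma>(2)[OF that]]) (use 1 in blast)+
    have 3: "\<sigma> z $ \<kappa> = normal_section f z $ \<kappa>" if "z \<in> \<Gamma>" "\<kappa> \<notin> {7, 8}" for z \<kappa>
      using 1[OF that(1)] 2[OF that(1)] that(2) exhaust_10[of \<kappa>] by blast
    have 4: "\<forall>\<kappa>\<in>{7, 8}. \<sigma> z $ \<kappa> = normal_section f z $ \<kappa>" if "z \<in> \<Gamma>" for z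
      using *[OF steps(3) that]
      by (subst (asm) third_loop_iff[OF \<Gamma> that _ \<sigma>(2)[OF that] 3]) (use 1 in blast)+
    have "\<sigma> z $ \<kappa> = normal_section f z $ \<kappa>" if "z \<in> \<Gamma>" for z \<kappa>
      using 3[OF that] 4[OF that] by blast
    then show "\<forall>z\<in>\<Gamma>. f 4 (z $ 1) * z $ 2 > 0 \<and> \<sigma> z = normal_section f z"
      using 1 by (simp add: vec_eq_iff)
  next
    assume *: "\<forall>z\<in>\<Gamma>. f 4 (z $ 1) * z $ 2 > 0 \<and> \<sigma> z = normal_section f z"
    then have p: "\<And>z. z \<in> \<Gamma> \<Longrightarrow> f 4 (z $ 1) * z $ 2 > 0"
      and \<sigma>: "\<And>z. z \<in> \<Gamma> \<Longrightarrow> \<sigma> z = normal_section f z" by blast+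
    have sg: "\<sigma> z \<in> structure_group" if "z \<in> \<Gamma>" for z
      using normal_section_nonzero[OF p[OF that]] by (simp add: \<sigma>[OF that] structure_group_def)
    have diff: "\<sigma> differentiable at z" if "z \<in> \<Gamma>" for z
    proof -
      have "(normal_section f has_derivative frechet_derivative (normal_section f) (at z)) (at z)"
        using normal_section_differentiable[OF J[OF that] p[OF that]]
        by (simp add: frechet_derivative_works)
      then have "(\<sigma> has_derivative frechet_derivative (normal_section f) (at z)) (at z)"
        by (rule has_derivative_transform_within_open[OF _ \<Gamma>(1) that]) (simp add: \<sigma>)
      then show ?thesis by (rule differentiableI)
    qed
    have ag: "\<sigma> y $ \<kappa> = normal_section f y $ \<kappa>" if "y \<in> \<Gamma>" for y \<kappa> using \<sigma>[OF that] by simp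
    have "normalization_step f \<Gamma> \<sigma> UNIV {4, 5, 7, 8, 9}
        {(2, 1, 2, 0), (2, 1, 3, 1), (3, 1, 4, 1), (4, 1, 5, 1), (5, 1, 6, 1)}"
      unfolding normalization_step_def K
    proof (intro ballI impI)
      fix z a assume z: "z \<in> \<Gamma>" and a: "a \<in> structure_group" "\<forall>\<kappa>\<in>{1, 2, 3, 6, 10}. a $ \<kappa> = \<sigma> z $ \<kappa>"
      have "a $ 1 > 0" using a(2) pos[OF z] by simp
      then have "\<forall>(i, j, k, c)\<in>{(2, 1, 2, 0), (2, 1, 3, 1), (3, 1, 4, 1), (4, 1, 5, 1), (5, 1, 6, 1)}.
          essential_torsion f UNIV \<sigma> (z, a) i j k c"
        unfolding first_loop_iff[OF J[OF z] a(1)] using first_loop_solution[OF J[OF z]] a(2) p[OF z] ag[OF z]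
        by metis
      then show "\<And>x. x \<in> {(2, 1, 2, 0), (2, 1, 3, 1), (3, 1, 4, 1), (4, 1, 5, 1), (5, 1, 6, 1)} \<Longrightarrow>
        case x of (i, j, k, c) \<Rightarrow> essential_torsion f UNIV \<sigma> (z, a) i j k c" by blast
    qed
    moreover have "normalization_step f \<Gamma> \<sigma> {4, 5, 7, 8, 9} {7, 8} {(3, 1, 2, 0), (3, 1, 3, 0), (5, 1, 5, 0)}"
      unfolding normalization_step_def K
    proof (intro ballI impI)
      fix z a assume z: "z \<in> \<Gamma>" and a: "\<forall>\<kappa>\<in>{4, 5, 9}. a $ \<kappa> = \<sigma> z $ \<kappa>"
      have "\<forall>(i, j, k, c)\<in>{(3, 1, 2, 0), (3, 1, 3, 0), (5, 1, 5, 0)}.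
          essential_torsion f {4, 5, 7, 8, 9} \<sigma> (z, a) i j k c"
        using second_loop_iff[OF \<Gamma> z p diff[OF z] ag] a ag[OF z] by simp
      then show "\<And>x. x \<in> {(3, 1, 2, 0), (3, 1, 3, 0), (5, 1, 5, 0)} \<Longrightarrow>
        case x of (i, j, k, c) \<Rightarrow> essential_torsion f {4, 5, 7, 8, 9} \<sigma> (z, a) i j k c" by blast
    qed
    moreover have "normalization_step f \<Gamma> \<sigma> {7, 8} {} {(4, 1, 2, 0), (4, 1, 3, 0)}"
      unfolding normalization_step_def K
    proof (intro ballI impI)
      fix z a assume z: "z \<in> \<Gamma>" and a: "\<forall>\<kappa>\<in>{7, 8}. a $ \<kappa> = \<sigma> z $ \<kappa>"
      have "\<forall>(i, j, k, c)\<in>{(4, 1, 2, 0), (4, 1, 3, 0)}. essential_torsion f {7, 8} \<sigma> (z, a) i j k c"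
        using third_loop_iff[OF \<Gamma> z p diff[OF z] ag] a ag[OF z] by simp
      then show "\<And>x. x \<in> {(4, 1, 2, 0), (4, 1, 3, 0)} \<Longrightarrow>
        case x of (i, j, k, c) \<Rightarrow> essential_torsion f {7, 8} \<sigma> (z, a) i j k c" by blast
    qed
    ultimately show "cartan_normalization f \<Gamma> \<sigma>"
      unfolding cartan_normalization_def using sg diff by blast
  qed
qed

end

section \<open>Structure equations of the invariant coframe\<close>

theorem theorem1:
  fixes f :: "nat \<Rightarrow> real \<Rightarrow> real" and U :: "real set" and \<Gamma> :: "(real^6) set"
  assumes "open U"
    and "\<And>i. i \<le> 4 \<Longrightarrow> real_analytic_on (f i) U"
    and "\<Gamma> \<in> components (jet_domain f U)"
  shows "((\<forall>z\<in>\<Gamma>. f 4 (z $ 1) * z $ 2 > 0) \<longrightarrow>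
            (\<exists>\<sigma>. cartan_normalization f \<Gamma> \<sigma> \<and> (\<forall>z\<in>\<Gamma>. \<sigma> z $ 1 > 0))) \<and>
    (\<forall>\<sigma>. cartan_normalization f \<Gamma> \<sigma> \<and> (\<forall>z\<in>\<Gamma>. \<sigma> z $ 1 > 0) \<longrightarrow>
      (let \<theta> = reduced_coframe f \<sigma> in
       \<forall>z\<in>\<Gamma>. \<forall>v w.
         ext_d (\<theta> 1) z v w = 1/4 * wedge (\<theta> 1 z) (\<theta> 2 z) v w \<and>
         ext_d (\<theta> 2) z v w = wedge (\<theta> 1 z) (\<theta> 3 z) v w \<and>
         ext_d (\<theta> 3) z v w = wedge (\<theta> 1 z) (\<theta> 4 z) v w
           + 1/4 * wedge (\<theta> 2 z) (\<theta> 3 z) v w \<and>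
         ext_d (\<theta> 4) z v w = inv1 f z * wedge (\<theta> 1 z) (\<theta> 4 z) v w
           + wedge (\<theta> 1 z) (\<theta> 5 z) v w + 1/2 * wedge (\<theta> 2 z) (\<theta> 4 z) v w \<and>
         ext_d (\<theta> 5) z v w = inv0 f z * wedge (\<theta> 1 z) (\<theta> 2 z) v w
           + inv2 f z * wedge (\<theta> 1 z) (\<theta> 3 z) v w + inv3 f z * wedge (\<theta> 1 z) (\<theta> 4 z) v w
           + wedge (\<theta> 1 z) (\<theta> 6 z) v w + 3/4 * wedge (\<theta> 2 z) (\<theta> 5 z) v w
           + 3 * wedge (\<theta> 3 z) (\<theta> 4 z) v w \<and>
         ext_d (\<theta> 6) z v w = 0))"
proof -
  interpret jet_space_operator f U
    using assms(1,2) by unfold_locales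
  have \<Gamma>: "open \<Gamma>" "\<Gamma> \<subseteq> J"
    using open_components[OF open_J assms(3)] in_components_subset[OF assms(3)] by blast+
  show ?thesis
  proof (intro conjI allI impI)
    assume p: "\<forall>z\<in>\<Gamma>. f 4 (z $ 1) * z $ 2 > 0"
    then have n: "\<forall>z\<in>\<Gamma>. normal_section f z $ 1 > 0"
      using normal_section_nonzero(1) by blast
    have "cartan_normalization f \<Gamma> (normal_section f)"
      using p n by (subst cartan_normalization_iff[OF \<Gamma>]) simp_all
    with n show "\<exists>\<sigma>. cartan_normalization f \<Gamma> \<sigma> \<and> (\<forall>z\<in>\<Gamma>. \<sigma> z $ 1 > 0)" by blast
  next
    fix \<sigma> assume "cartan_normalization f \<Gamma> \<sigma> \<and> (\<forall>z\<in>\<Gamma>. \<sigma> z $ 1 > 0)"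
    then have p: "\<And>z. z \<in> \<Gamma> \<Longrightarrow> f 4 (z $ 1) * z $ 2 > 0"
      and \<sigma>: "\<And>z. z \<in> \<Gamma> \<Longrightarrow> \<sigma> z = normal_section f z"
      using cartan_normalization_iff[OF \<Gamma>, of \<sigma>] by blast+
    have r: "reduced_coframe f \<sigma> i z = reduced_coframe f (normal_section f) i z" if "z \<in> \<Gamma>" for i z
      by (simp add: reduced_coframe_def \<sigma>[OF that])
    have e: "ext_d (reduced_coframe f \<sigma> i) z v w = ext_d (reduced_coframe f (normal_section f) i) z v w"
      if "z \<in> \<Gamma>" for i z v w
      by (rule ext_d_cong[OF \<Gamma>(1) that]) (simp add: r)
    have J: "z \<in> J" if "z \<in> \<Gamma>" for z using \<Gamma>(2) that by blast
    show "let \<theta> = reduced_coframe f \<sigma> in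
       \<forall>z\<in>\<Gamma>. \<forall>v w.
         ext_d (\<theta> 1) z v w = 1/4 * wedge (\<theta> 1 z) (\<theta> 2 z) v w \<and>
         ext_d (\<theta> 2) z v w = wedge (\<theta> 1 z) (\<theta> 3 z) v w \<and>
         ext_d (\<theta> 3) z v w = wedge (\<theta> 1 z) (\<theta> 4 z) v w
           + 1/4 * wedge (\<theta> 2 z) (\<theta> 3 z) v w \<and>
         ext_d (\<theta> 4) z v w = inv1 f z * wedge (\<theta> 1 z) (\<theta> 4 z) v w
           + wedge (\<theta> 1 z) (\<theta> 5 z) v w + 1/2 * wedge (\<theta> 2 z) (\<theta> 4 z) v w \<and>
         ext_d (\<theta> 5) z v w = inv0 f z * wedge (\<theta> 1 z) (\<theta> 2 z) v w
           + inv2 f z * wedge (\<theta> 1 z) (\<theta> 3 z) v w + inv3 f z * wedge (\<theta> 1 z) (\<theta> 4 z) v w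
           + wedge (\<theta> 1 z) (\<theta> 6 z) v w + 3/4 * wedge (\<theta> 2 z) (\<theta> 5 z) v w
           + 3 * wedge (\<theta> 3 z) (\<theta> 4 z) v w \<and>
         ext_d (\<theta> 6) z v w = 0"
      unfolding Let_def
      by (intro ballI allI, simp only: e r)
        (intro conjI structure_equations_123 structure_equation_4 structure_equation_5 J p;
          simp add: reduced_coframe_simps ext_d_omega J)
  qed
qed

end
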